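(* Let $\sigma=\lambda/\nu$ be a balanced skew shape of height $a$ and width $b$, and let $w\in\mathfrak{S}_n$ be a skew vexillary permutation of shape $\sigma$. Then the weak order interval $[e,w]$ is toggle CDE (tCDE) with edge density $ab/(a+b)$; that is, $\mathbb{E}(\mu;\mathrm{ddeg})=\mathbb{E}(\mathrm{uni}_{[e,w]};\mathrm{ddeg})=ab/(a+b)$ for every toggle-symmetric probability distribution $\mu$ on $[e,w]$.
   Context: Weak order: For $w\in\mathfrak{S}_n$, $\mathrm{Inv}(w)=\{(i,j): 1\le i<j\le n,\ w(i)>w(j)\}$ and $\mathrm{Inv}^{-1}(w)=\mathrm{Inv}(w^{-1})$. Weak order on $\mathfrak{S}_n$ is: $u\le w$ iff $\mathrm{Inv}^{-1}(u)\subseteq \mathrm{Inv}^{-1}(w)$; equivalently, it is the partial order whose cover relations are $u\lessdot us_k$ with $u(k)<u(k+1)$, $s_k$ the simple transposition of $k,k+1$. $e$ is the identity; $[e,w]=\{u:e\le u\le w\}$. Every such interval is a finite semidistributive lattice. $\mathrm{ddeg}(p)$ is the number of elements of the poset covered by $p$; $\mathrm{uni}_P$ is the uniform distribution on $P$; $\mathbb{E}(\mu;f)$ is expectation of $f$ under $\mu$; the edge density of $P$ is $\mathbb{E}(\mathrm{uni}_P;\mathrm{ddeg})$. Toggling: A finite lattice $L$ is semidistributive if every element has a canonical join representation and a canonical meet representation (equivalently, $x\vee y=x\vee z$ implies $x\vee y=x\vee(y\wedge z)$, and dually). For such $L$ and a cover relation $x\lessdot y$, put $\gamma(x\lessdot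 y)=\min\{z\in L:x\vee z=y\}$, which exists and lies in the set $\mathrm{Irr}(L)$ of join-irreducible elements. For each $y$, each $p\in\mathrm{Irr}(L)$ labels at most one cover relation involving $y$. For $p\in\mathrm{Irr}(L)$: $\mathcal{T}^+_p(y)=1$ if there is $z$ with $y\lessdot z$, $\gamma(y\lessdot z)=p$, and $0$ otherwise; $\mathcal{T}^-_p(y)=1$ if there is $x$ with $x\lessdot y$, $\gamma(x\lessdot y)=p$, and $0$ otherwise; $\mathcal{T}_p=\mathcal{T}^+_p-\mathcal{T}^-_p$. A probability distribution $\mu$ on $L$ is toggle-symmetric if $\mathbb{E}(\mu;\mathcal{T}_p)=0$ for all $p\in\mathrm{Irr}(L)$. $L$ is tCDE if $\mathbb{E}(\mu;\mathrm{ddeg})=\mathbb{E}(\mathrm{uni}_L;\mathrm{ddeg})$ for every toggle-symmetric $\mu$ on $L$. Shapes: A diagram is a finite subset of $\mathbb{Z}^2$ of boxes $(i,j)$ in matrix coordinates ($i$ = row, increasing downwards; $j$ = column, increasing rightwards). A partition $\lambda$ is identified with its Young diagram $\{(i,j):1\le i\le \ell(\lambda),1\le j\le\lambda_i\}$. For partitions with $\nu_i\le\lambda_i$ for all $i$, the skew shape $\sigma=\lambda/\nu$ is the set difference of the Young diagrams. $\sigma$ is connected if the Hasse diagram of the poset on its boxes (with order induced from the componentwise order on $\mathbb{Z}^2$) is connected (in particular nonempty). A connected $\sigma$ has height $a$ and width $b$ if $[a]\times[b]$ is the smallest rectangle containing $\sigma$ up to translation. Translate $\sigma$ into $[a]\times[b]$;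 its main antidiagonal is the line joining the northeast and southwest corners of the boundary of this rectangle. A corner of $\sigma$ is a point where two line segments that are part of the boundary of $\sigma$ meet; it is outward if no box of $\sigma$ intersects both line segments (except at the corner point). (Equivalently, outward corners are the lattice points, at the southeast corner of position $(p,q)$, such that exactly three of $(p,q),(p,q+1),(p+1,q),(p+1,q+1)$ lie in $\sigma$; such a point is on the main antidiagonal iff $pb+qa=ab$.) $\sigma$ is balanced if it is connected and all its outward corners lie exactly on its main antidiagonal. Skew vexillary: The Rothe diagram of $w$ is $\{(i,w(j)):(i,j)\in \mathrm{Inv}(w)\}$. $w$ is skew vexillary of shape $\sigma$ if its Rothe diagram can be transformed to $\sigma$ by some permutation of rows and columns (rows and columns being permuted separately). *)

theory Defs
  imports "HOL-Algebra.Lattice" "HOL-Probability.Probability_Mass_Function"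
begin

section \<open>Finite semidistributive lattices and toggling\<close>

definition covers :: "('a, 'b) gorder_scheme \<Rightarrow> 'a \<Rightarrow> 'a \<Rightarrow> bool" where
  "covers L x y \<longleftrightarrow> x \<in> carrier L \<and> y \<in> carrier L \<and> x \<sqsubset>\<^bsub>L\<^esub> y \<and>
     \<not> (\<exists>z\<in>carrier L. x \<sqsubset>\<^bsub>L\<^esub> z \<and> z \<sqsubset>\<^bsub>L\<^esub> y)"

definition ddeg :: "('a, 'b) gorder_scheme \<Rightarrow> 'a \<Rightarrow> nat" where
  "ddeg L y = card {x. covers L x y}"

locale finite_semidistributive_lattice = lattice L for L (structure) +
  assumes finite_carrier: "finite (carrier L)"
    and carrier_nonempty: "carrier L \<noteq> {}"
    and join_semidistributive:
      "\<lbrakk>x \<in> carrier L; y \<in> carrier L; z \<in> carrier L; x \<squnion> y = x \<squnion> z\<rbrakk>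
        \<Longrightarrow> x \<squnion> y = x \<squnion> (y \<sqinter> z)"
    and meet_semidistributive:
      "\<lbrakk>x \<in> carrier L; y \<in> carrier L; z \<in> carrier L; x \<sqinter> y = x \<sqinter> z\<rbrakk>
        \<Longrightarrow> x \<sqinter> y = x \<sqinter> (y \<squnion> z)"

definition join_irreducibles :: "('a, 'b) gorder_scheme \<Rightarrow> 'a set" where
  "join_irreducibles L = {p \<in> carrier L. \<not> least L p (carrier L) \<and>
     (\<forall>x\<in>carrier L. \<forall>y\<in>carrier L. p = x \<squnion>\<^bsub>L\<^esub> y \<longrightarrow> p = x \<or> p = y)}"

text \<open>The least element below exists in a finite semidistributive lattice whenever
  \<open>y\<close> covers \<open>x\<close>; \<open>cover_label\<close> is only used for such covers.\<close>

definition cover_label :: "('a, 'b) gorder_scheme \<Rightarrow> 'a \<Rightarrow> 'a \<Rightarrow> 'a" where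
  "cover_label L x y = (THE p. least L p {z \<in> carrier L. x \<squnion>\<^bsub>L\<^esub> z = y})"

definition toggle_in :: "('a, 'b) gorder_scheme \<Rightarrow> 'a \<Rightarrow> 'a \<Rightarrow> real" where
  "toggle_in L p y = (if \<exists>z. covers L y z \<and> cover_label L y z = p then 1 else 0)"

definition toggle_out :: "('a, 'b) gorder_scheme \<Rightarrow> 'a \<Rightarrow> 'a \<Rightarrow> real" where
  "toggle_out L p y = (if \<exists>x. covers L x y \<and> cover_label L x y = p then 1 else 0)"

definition toggleability :: "('a, 'b) gorder_scheme \<Rightarrow> 'a \<Rightarrow> 'a \<Rightarrow> real" where
  "toggleability L p y = toggle_in L p y - toggle_out L p y"

definition toggle_symmetric :: "('a, 'b) gorder_scheme \<Rightarrow> 'a pmf \<Rightarrow> bool" where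
  "toggle_symmetric L \<mu> \<longleftrightarrow> set_pmf \<mu> \<subseteq> carrier L \<and>
     (\<forall>p\<in>join_irreducibles L. measure_pmf.expectation \<mu> (toggleability L p) = 0)"

definition edge_density :: "('a, 'b) gorder_scheme \<Rightarrow> real" where
  "edge_density L = measure_pmf.expectation (pmf_of_set (carrier L)) (\<lambda>y. real (ddeg L y))"

definition tCDE :: "('a, 'b) gorder_scheme \<Rightarrow> bool" where
  "tCDE L \<longleftrightarrow> finite_semidistributive_lattice L \<and>
     (\<forall>\<mu>. toggle_symmetric L \<mu> \<longrightarrow>
        measure_pmf.expectation \<mu> (\<lambda>y. real (ddeg L y)) = edge_density L)"


section \<open>Weak order on the symmetric group\<close>

definition Inv :: "nat \<Rightarrow> (nat \<Rightarrow> nat) \<Rightarrow> (nat \<times> nat) set" where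
  "Inv n w = {(i, j). 1 \<le> i \<and> i < j \<and> j \<le> n \<and> w i > w j}"

definition weak_order :: "nat \<Rightarrow> (nat \<Rightarrow> nat) gorder" where
  "weak_order n = \<lparr>carrier = {w. w permutes {1..n}}, eq = (=),
     le = \<lambda>u w. Inv n (inv u) \<subseteq> Inv n (inv w)\<rparr>"

definition weak_interval :: "nat \<Rightarrow> (nat \<Rightarrow> nat) \<Rightarrow> (nat \<Rightarrow> nat) gorder" where
  "weak_interval n w = (weak_order n)\<lparr>carrier := \<lbrace>id..w\<rbrace>\<^bsub>weak_order n\<^esub>\<rparr>"


section \<open>Shapes\<close>

type_synonym diagram = "(int \<times> int) set"

text \<open>A partition is the sequence of its parts, indexed from 1 and padded with zeros; the
  value at 0 plays no role.\<close>

definition is_partition :: "(nat \<Rightarrow> nat) \<Rightarrow> bool" where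
  "is_partition p \<longleftrightarrow> (\<forall>i\<ge>1. p (Suc i) \<le> p i) \<and> finite {i. p i \<noteq> 0}"

definition young_diagram :: "(nat \<Rightarrow> nat) \<Rightarrow> diagram" where
  "young_diagram p = {(int i, int j) | i j. 1 \<le> i \<and> 1 \<le> j \<and> j \<le> p i}"

definition skew_diagram :: "(nat \<Rightarrow> nat) \<Rightarrow> (nat \<Rightarrow> nat) \<Rightarrow> diagram" where
  "skew_diagram lam nu = young_diagram lam - young_diagram nu"

definition box_poset :: "diagram \<Rightarrow> (int \<times> int) gorder" where
  "box_poset D = \<lparr>carrier = D, eq = (=), le = \<lambda>(i, j) (k, l). i \<le> k \<and> j \<le> l\<rparr>"

definition connected_diagram :: "diagram \<Rightarrow> bool" where
  "connected_diagram D \<longleftrightarrow> D \<noteq> {} \<and> (\<forall>x\<in>D. \<forall>y\<in>D. equivclp (covers (box_poset D)) x y)"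

definition translate :: "int \<times> int \<Rightarrow> diagram \<Rightarrow> diagram" where
  "translate d D = (\<lambda>(i, j). (i + fst d, j + snd d)) ` D"

definition rectangle :: "nat \<Rightarrow> nat \<Rightarrow> diagram" where
  "rectangle a b = {1..int a} \<times> {1..int b}"

definition has_height_width :: "diagram \<Rightarrow> nat \<Rightarrow> nat \<Rightarrow> bool" where
  "has_height_width D a b \<longleftrightarrow> (\<exists>d. translate d D \<subseteq> rectangle a b) \<and>
     (\<forall>a' b' d. translate d D \<subseteq> rectangle a' b' \<longrightarrow> a \<le> a' \<and> b \<le> b')"

text \<open>The box \<open>(i, j)\<close> is the unit square with southeast corner at the lattice point
  \<open>(i, j)\<close>. In a connected skew shape the boundary turns at \<open>(p, q)\<close> exactly when one or
  three of the four surrounding unit squares are boxes, and the corner is outward (no box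
  meets both boundary segments apart from the corner) in the latter case.\<close>

definition outward_corner :: "diagram \<Rightarrow> int \<Rightarrow> int \<Rightarrow> bool" where
  "outward_corner D p q \<longleftrightarrow> card (D \<inter> {(p, q), (p, q + 1), (p + 1, q), (p + 1, q + 1)}) = 3"

text \<open>The line through the northeast corner \<open>(0, b)\<close> and the southwest corner \<open>(a, 0)\<close>
  of the boundary of \<open>rectangle a b\<close>.\<close>

definition on_main_antidiagonal :: "nat \<Rightarrow> nat \<Rightarrow> int \<Rightarrow> int \<Rightarrow> bool" where
  "on_main_antidiagonal a b p q \<longleftrightarrow> p * int b + q * int a = int a * int b"

text \<open>For a nonempty finite \<open>D\<close> the data \<open>a\<close>, \<open>b\<close>, \<open>d\<close> quantified here exist and are
  unique.\<close>

definition balanced :: "diagram \<Rightarrow> bool" where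
  "balanced D \<longleftrightarrow> connected_diagram D \<and>
     (\<forall>a b d. has_height_width D a b \<and> translate d D \<subseteq> rectangle a b \<longrightarrow>
        (\<forall>p q. outward_corner (translate d D) p q \<longrightarrow> on_main_antidiagonal a b p q))"


section \<open>Skew vexillary permutations\<close>

definition rothe_diagram :: "nat \<Rightarrow> (nat \<Rightarrow> nat) \<Rightarrow> diagram" where
  "rothe_diagram n w = {(int i, int (w j)) | i j. (i, j) \<in> Inv n w}"

text \<open>Rows and columns are permuted within the whole of the integer grid, since a skew shape
  may have empty rows or columns and so need not lie inside the \<open>n \<times> n\<close> square.\<close>

definition vexillary_of_shape :: "nat \<Rightarrow> (nat \<Rightarrow> nat) \<Rightarrow> diagram \<Rightarrow> bool" where
  "vexillary_of_shape n w D \<longleftrightarrow>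
     (\<exists>f g. bij f \<and> bij g \<and> (\<lambda>(i, j). (f i, g j)) ` rothe_diagram n w = D)"

end

theory Submission
  imports Defs "HOL-Combinatorics.Permutations"
begin

text \<open>An element \<open>u\<close> of \<open>[e, w]\<close> is handled through its inversion set \<open>Inv n (inv u)\<close>, a set of pairs
  of values closed under composition and with composition-closed complement; on such sets joins are
  transitive closures, which makes semidistributivity accessible. The label of a cover that swaps
  the adjacent values \<open>x < y\<close> amounts to the pair \<open>(x, y)\<close> together with the set of values
  between \<open>x\<close> and \<open>y\<close> that stand to the left.

  For an inversion \<open>(x0, y0)\<close> of \<open>w\<close> whose row and column span a rectangle inside the Rothe
  diagram, the letters of \<open>u\<close> between \<open>x0\<close> and \<open>y0\<close> are partitioned into column indices of the row
  of \<open>y0\<close> and row indices of the column of \<open>x0\<close>. Telescoping the signed number of steps from one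
  kind to the other gives a combination of toggles (a rook) that is constantly 1. Under a
  toggle-symmetric distribution its expectation is the expected number of descents in the row plus
  that in the column of the box. Summing over the boxes met by the main antidiagonal, with
  multiplicities, attacks every column \<open>a\<close> times and every row \<open>b\<close> times; balancedness ensures
  that these boxes lie in the shape and have the rectangle property.\<close>

section \<open>Biclosed sets and inversion sets\<close>

definition pairs :: "nat \<Rightarrow> (nat \<times> nat) set" where
  "pairs n = {(i, j). 1 \<le> i \<and> i < j \<and> j \<le> n}"

definition biclosed :: "nat \<Rightarrow> (nat \<times> nat) set \<Rightarrow> bool" where
  "biclosed n A \<longleftrightarrow> A \<subseteq> pairs n \<and> trans A \<and>
     (\<forall>i j k. (i, k) \<in> A \<longrightarrow> i < j \<longrightarrow> j < k \<longrightarrow> (i, j) \<in> A \<or> (j, k) \<in> A)"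

definition bijoin :: "(nat \<times> nat) set \<Rightarrow> (nat \<times> nat) set \<Rightarrow> (nat \<times> nat) set" where
  "bijoin A B = (A \<union> B)\<^sup>+"

text \<open>Complementation in \<open>pairs n\<close> preserves biclosed sets and reverses
  inclusion, so the meet is the dual of the join; a plain intersection may fail to be
  cotransitive.\<close>

definition bimeet :: "nat \<Rightarrow> (nat \<times> nat) set \<Rightarrow> (nat \<times> nat) set \<Rightarrow> (nat \<times> nat) set" where
  "bimeet n A B = pairs n - bijoin (pairs n - A) (pairs n - B)"

lemma trans_pairs: "trans (pairs n)"
  by (auto simp: pairs_def trans_def)

lemma biclosed_subset: "biclosed n A \<Longrightarrow> A \<subseteq> pairs n"
  by (simp add: biclosed_def)

lemma biclosed_trans: "biclosed n A \<Longrightarrow> (i, j) \<in> A \<Longrightarrow> (j, k) \<in> A \<Longrightarrow> (i, k) \<in> A"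
  by (auto simp: biclosed_def dest: transD)

lemma biclosed_cotrans:
  "biclosed n A \<Longrightarrow> (i, k) \<in> A \<Longrightarrow> i < j \<Longrightarrow> j < k \<Longrightarrow> (i, j) \<in> A \<or> (j, k) \<in> A"
  by (auto simp: biclosed_def)

lemma biclosed_less: "biclosed n A \<Longrightarrow> (i, j) \<in> A \<Longrightarrow> 1 \<le> i \<and> i < j \<and> j \<le> n"
  by (auto simp: biclosed_def pairs_def)

lemma bijoin_upper1: "A \<subseteq> bijoin A B" and bijoin_upper2: "B \<subseteq> bijoin A B"
  unfolding bijoin_def by auto

lemma bijoin_least: "A \<subseteq> C \<Longrightarrow> B \<subseteq> C \<Longrightarrow> trans C \<Longrightarrow> bijoin A B \<subseteq> C"
  unfolding bijoin_def using trancl_mono[of _ "A \<union> B" C] trancl_id[of C] by auto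

text \<open>Chains of pairs are increasing, so a value \<open>j\<close> between the ends is either a
  vertex of the chain or is jumped over by one pair of \<open>A\<close> or \<open>B\<close>, which
  cotransitivity splits at \<open>j\<close>.\<close>

lemma biclosed_bijoin:
  assumes A: "biclosed n A" and B: "biclosed n B"
  shows "biclosed n (bijoin A B)"
proof -
  have "(i, k) \<in> (A \<union> B)\<^sup>+ \<Longrightarrow>
    \<forall>j. i < j \<longrightarrow> j < k \<longrightarrow> (i, j) \<in> (A \<union> B)\<^sup>+ \<or> (j, k) \<in> (A \<union> B)\<^sup>+" for i k
  proof (induction rule: trancl_induct)
    case (base k)
    then show ?case
      using biclosed_cotrans[OF A, of i k] biclosed_cotrans[OF B, of i k] by blast
  next
    case (step k l)
    show ?case
    proof (intro allI impI)
      fix j assume j: "i < j" "j < l"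
      consider "j < k" | "j = k" | "k < j" by linarith
      then show "(i, j) \<in> (A \<union> B)\<^sup>+ \<or> (j, l) \<in> (A \<union> B)\<^sup>+"
      proof cases
        case 1
        then show ?thesis using step j by (meson trancl.trancl_into_trancl)
      next
        case 2
        then show ?thesis using step by auto
      next
        case 3
        then have "(k, j) \<in> A \<union> B \<or> (j, l) \<in> A \<union> B"
          using step(2) j biclosed_cotrans[OF A, of k l j] biclosed_cotrans[OF B, of k l j] by blast
        then show ?thesis using step(1) by (meson r_into_trancl' trancl.trancl_into_trancl)
      qed
    qed
  qed
  moreover have "bijoin A B \<subseteq> pairs n"
    using A B by (intro bijoin_least trans_pairs biclosed_subset)
  ultimately show ?thesis
    unfolding biclosed_def bijoin_def by (simp add: trans_trancl)
qed

lemma biclosed_compl: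
  assumes A: "biclosed n A"
  shows "biclosed n (pairs n - A)"
proof -
  have "(i, k) \<in> pairs n - A" if "(i, j) \<in> pairs n - A" "(j, k) \<in> pairs n - A" for i j k
    using that biclosed_cotrans[OF A, of i k j] by (auto simp: pairs_def)
  moreover have "(i, j) \<in> pairs n - A \<or> (j, k) \<in> pairs n - A"
    if "(i, k) \<in> pairs n - A" "i < j" "j < k" for i j k
    using that biclosed_trans[OF A, of i j k] by (auto simp: pairs_def)
  ultimately show ?thesis
    unfolding biclosed_def by (intro conjI allI impI transI) (assumption | fact | rule Diff_subset)+
qed

lemma biclosed_bimeet: "biclosed n A \<Longrightarrow> biclosed n B \<Longrightarrow> biclosed n (bimeet n A B)"
  unfolding bimeet_def by (intro biclosed_compl biclosed_bijoin)

lemma bimeet_lower1: "A \<subseteq> pairs n \<Longrightarrow> bimeet n A B \<subseteq> A"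
  and bimeet_lower2: "B \<subseteq> pairs n \<Longrightarrow> bimeet n A B \<subseteq> B"
  unfolding bimeet_def
  using bijoin_upper1[of "pairs n - A" "pairs n - B"] bijoin_upper2[of "pairs n - B" "pairs n - A"] by blast+

lemma bimeet_greatest:
  assumes "biclosed n C" "C \<subseteq> A" "C \<subseteq> B"
  shows "C \<subseteq> bimeet n A B"
proof -
  have "bijoin (pairs n - A) (pairs n - B) \<subseteq> pairs n - C"
    using assms biclosed_compl[OF assms(1)]
    by (intro bijoin_least) (auto simp: biclosed_def)
  then show ?thesis
    using biclosed_subset[OF assms(1)] unfolding bimeet_def by blast
qed

section \<open>Biclosed sets as inversion sets of permutations\<close>

lemma biclosed_Inv: "biclosed n (Inv n v)"
  unfolding biclosed_def Inv_def pairs_def trans_def by auto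

lemma Inv_iff: "(i, j) \<in> Inv n v \<longleftrightarrow> 1 \<le> i \<and> i < j \<and> j \<le> n \<and> v j < v i"
  by (simp add: Inv_def)

lemma Inv_id: "Inv n id = {}"
  by (auto simp: Inv_def)

lemma permutes_eq_card:
  fixes v :: "nat \<Rightarrow> nat"
  assumes v: "v permutes {1..n}" and a: "a \<in> {1..n}"
  shows "v a = card {b \<in> {1..n}. v b \<le> v a}"
proof -
  have "v ` {b \<in> {1..n}. v b \<le> v a} = {1..v a}"
  proof
    show "v ` {b \<in> {1..n}. v b \<le> v a} \<subseteq> {1..v a}"
    proof
      fix c assume "c \<in> v ` {b \<in> {1..n}. v b \<le> v a}"
      then obtain b where b: "b \<in> {1..n}" "c = v b" "v b \<le> v a" by blast
      then show "c \<in> {1..v a}" using permutes_in_image[OF v, of b] by simp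
    qed
    show "{1..v a} \<subseteq> v ` {b \<in> {1..n}. v b \<le> v a}"
    proof
      fix c assume c: "c \<in> {1..v a}"
      have "v a \<le> n" using permutes_in_image[OF v] a by (metis atLeastAtMost_iff)
      then have "c \<in> v ` {1..n}" using c permutes_image[OF v] by auto
      then show "c \<in> v ` {b \<in> {1..n}. v b \<le> v a}" using c by auto
    qed
  qed
  then have "card (v ` {b \<in> {1..n}. v b \<le> v a}) = v a" by simp
  then show ?thesis using card_image[OF permutes_inj_on[OF v]] by metis
qed

text \<open>The inversion set decides every comparison of \<open>v a\<close> with
  \<open>v b\<close>, and \<open>v a\<close> is the rank of \<open>a\<close> under these comparisons
  (\<open>permutes_eq_card\<close>).\<close>

lemma Inv_inject:
  assumes v: "v permutes {1..n}" and v': "v' permutes {1..n}" and eq: "Inv n v = Inv n v'"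
  shows "v = v'"
proof
  fix a
  show "v a = v' a"
  proof (cases "a \<in> {1..n}")
    case True
    have "v b \<le> v a \<longleftrightarrow> v' b \<le> v' a" if b: "b \<in> {1..n}" for b
    proof -
      have "b < a \<Longrightarrow> v b \<le> v a \<longleftrightarrow> (b, a) \<notin> Inv n v" "b < a \<Longrightarrow> v' b \<le> v' a \<longleftrightarrow> (b, a) \<notin> Inv n v'"
        using b True by (auto simp: Inv_iff)
      moreover have "a < b \<Longrightarrow> v b \<le> v a \<longleftrightarrow> (a, b) \<in> Inv n v" "a < b \<Longrightarrow> v' b \<le> v' a \<longleftrightarrow> (a, b) \<in> Inv n v'"
        using b True permutes_inj[OF v] permutes_inj[OF v']
        by (auto simp: Inv_iff le_less inj_eq)
      ultimately show ?thesis using eq by (cases a b rule: linorder_cases) auto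
    qed
    then have "{b \<in> {1..n}. v b \<le> v a} = {b \<in> {1..n}. v' b \<le> v' a}" by auto
    then show ?thesis using permutes_eq_card[OF v True] permutes_eq_card[OF v' True] by simp
  next
    case False
    then show ?thesis using v v' by (simp add: permutes_not_in)
  qed
qed

text \<open>Reversing the natural order on exactly the pairs of \<open>B\<close> gives a total
  order: transitivity of \<open>before\<close> reduces to transitivity or cotransitivity of
  \<open>B\<close>, depending on the relative size of the three values. The permutation sends each
  element to its rank.\<close>

lemma biclosed_imp_Inv:
  assumes B: "biclosed n B"
  obtains v where "v permutes {1..n}" "Inv n v = B"
proof -
  define before where "before a b \<longleftrightarrow> (a < b \<and> (a, b) \<notin> B) \<or> (b < a \<and> (b, a) \<in> B)" for a b
  have before_trans: "before a c" if ab: "before a b" and bc: "before b c" for a b c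
  proof -
    consider "a < b \<and> b < c" | "a < c \<and> c < b" | "b < a \<and> a < c" | "b < c \<and> c < a"
      | "c < a \<and> a < b" | "c < b \<and> b < a" | "a = c"
      using ab bc unfolding before_def by linarith
    then show ?thesis
    proof cases
      case 1 then show ?thesis using ab bc biclosed_cotrans[OF B, of a c b] by (auto simp: before_def)
    next
      case 2 then show ?thesis using ab bc biclosed_trans[OF B, of a c b] by (auto simp: before_def)
    next
      case 3 then show ?thesis using ab bc biclosed_trans[OF B, of b a c] by (auto simp: before_def)
    next
      case 4 then show ?thesis using ab bc biclosed_cotrans[OF B, of b a c] by (auto simp: before_def)
    next
      case 5 then show ?thesis using ab bc biclosed_cotrans[OF B, of c b a] by (auto simp: before_def)
    next
      case 6 then show ?thesis using ab bc biclosed_trans[OF B, of c b a] by (auto simp: before_def)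
    next
      case 7 then show ?thesis using ab bc by (auto simp: before_def)
    qed
  qed
  have irr: "\<not> before a a" for a by (simp add: before_def)
  \<comment> \<open>Counting \<open>a\<close> itself makes the ranks start at 1; outside
    \<open>{1..n}\<close> a permutation has to be the identity.\<close>
  define v where "v a = (if a \<in> {1..n} then card {b \<in> {1..n}. b = a \<or> before b a} else a)" for a
  have mono: "v a < v b" if "before a b" "a \<in> {1..n}" "b \<in> {1..n}" for a b
  proof -
    have "\<not> before b a" using before_trans[of a b a] irr that by blast
    then have "b \<notin> {c \<in> {1..n}. c = a \<or> before c a}" using irr that by auto
    moreover have "{c \<in> {1..n}. c = a \<or> before c a} \<subseteq> {c \<in> {1..n}. c = b \<or> before c b}"
      using that before_trans[OF _ that(1)] by auto
    ultimately have "{c \<in> {1..n}. c = a \<or> before c a} \<subset> {c \<in> {1..n}. c = b \<or> before c b}"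
      using that by blast
    from psubset_card_mono[OF _ this] show ?thesis using that by (simp add: v_def)
  qed
  have tot: "before a b \<or> before b a \<or> a = b" for a b
    unfolding before_def by (cases a b rule: linorder_cases) auto
  have "inj_on v {1..n}"
    by (rule inj_onI) (metis mono tot less_irrefl)
  moreover have "v ` {1..n} \<subseteq> {1..n}"
  proof
    fix c assume "c \<in> v ` {1..n}"
    then obtain a where a: "a \<in> {1..n}" "c = card {b \<in> {1..n}. b = a \<or> before b a}"
      by (auto simp: v_def)
    have "card {b \<in> {1..n}. b = a \<or> before b a} \<le> card {1..n}" by (rule card_mono) auto
    moreover have "a \<in> {b \<in> {1..n}. b = a \<or> before b a}" using a by auto
    then have "card {b \<in> {1..n}. b = a \<or> before b a} > 0" by (auto simp: card_gt_0_iff)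
    ultimately show "c \<in> {1..n}" using a by auto
  qed
  ultimately have "bij_betw v {1..n} {1..n}"
    by (simp add: bij_betw_def endo_inj_surj)
  then have "v permutes {1..n}" by (intro bij_imp_permutes) (auto simp: v_def)
  moreover have "(i, j) \<in> Inv n v \<longleftrightarrow> (i, j) \<in> B" for i j
  proof (cases "1 \<le> i \<and> i < j \<and> j \<le> n")
    case True
    then show ?thesis
      using mono[of i j] mono[of j i] by (cases "(i, j) \<in> B") (auto simp: Inv_iff before_def)
  next
    case False
    then show ?thesis using biclosed_less[OF B, of i j] by (auto simp: Inv_iff)
  qed
  ultimately show ?thesis using that[of v] by (simp add: set_eq_iff)
qed

section \<open>Adjacent transpositions and descents\<close>

lemma transpose_Suc_less_iff:
  fixes p q k :: nat
  assumes "\<not> (q = k \<and> p = Suc k)" "p \<noteq> q"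
  shows "Transposition.transpose k (Suc k) q < Transposition.transpose k (Suc k) p \<longleftrightarrow>
    q < p \<or> (p = k \<and> q = Suc k)"
  using assms unfolding Transposition.transpose_def by presburger

text \<open>\<open>Inv n (inv u)\<close> consists of the pairs of values whose larger member stands
  to the left in the word of \<open>u\<close>. Swapping two neighbouring letters alters only their
  mutual order.\<close>

lemma Inv_adjacent:
  assumes u: "u permutes {1..n}" and k: "1 \<le> k" "k < n" and asc: "u k < u (Suc k)"
  defines "v \<equiv> u \<circ> Transposition.transpose k (Suc k)"
  shows "v permutes {1..n}"
    and "Inv n (inv v) = insert (u k, u (Suc k)) (Inv n (inv u))"
    and "(u k, u (Suc k)) \<notin> Inv n (inv u)"
proof -
  have t: "Transposition.transpose k (Suc k) permutes {1..n}"
    using k by (intro permutes_swap_id) auto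
  show v: "v permutes {1..n}"
    unfolding v_def by (rule permutes_compose[OF t u])
  have "inv v = Transposition.transpose k (Suc k) \<circ> inv u"
    unfolding v_def using permutes_bij[OF u] by (simp add: o_inv_distrib)
  then have iv: "inv v a = Transposition.transpose k (Suc k) (inv u a)" for a by simp
  have pos: "inv u a = k \<longleftrightarrow> a = u k" "inv u a = Suc k \<longleftrightarrow> a = u (Suc k)" for a
    using permutes_inv_eq[OF u] by auto
  have range: "u k \<in> {1..n}" "u (Suc k) \<in> {1..n}"
    using permutes_in_image[OF u] k by auto
  show "(u k, u (Suc k)) \<notin> Inv n (inv u)"
    by (simp add: Inv_iff permutes_inverses[OF u])
  have "(i, j) \<in> Inv n (inv v) \<longleftrightarrow> (i, j) \<in> insert (u k, u (Suc k)) (Inv n (inv u))" for i j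
  proof (cases "i < j")
    case True
    then have ne: "inv u i \<noteq> inv u j" using permutes_inj[OF permutes_inv[OF u]] by (auto simp: inj_eq)
    have "\<not> (inv u j = k \<and> inv u i = Suc k)" using pos True asc by auto
    then have "inv v j < inv v i \<longleftrightarrow> inv u j < inv u i \<or> (inv u i = k \<and> inv u j = Suc k)"
      unfolding iv using ne by (intro transpose_Suc_less_iff)
    then have "inv v j < inv v i \<longleftrightarrow> inv u j < inv u i \<or> (i = u k \<and> j = u (Suc k))"
      unfolding pos .
    then show ?thesis using range True by (simp add: Inv_iff) blast
  next
    case False
    then show ?thesis using asc by (auto simp: Inv_iff)
  qed
  then show "Inv n (inv v) = insert (u k, u (Suc k)) (Inv n (inv u))" by auto
qed

lemma Inv_adjacent_descent:
  assumes u: "u permutes {1..n}" and k: "1 \<le> k" "k < n" and desc: "u (Suc k) < u k"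
  defines "v \<equiv> u \<circ> Transposition.transpose k (Suc k)"
  shows "v permutes {1..n}"
    and "Inv n (inv u) = insert (u (Suc k), u k) (Inv n (inv v))"
    and "(u (Suc k), u k) \<notin> Inv n (inv v)"
proof -
  have t: "Transposition.transpose k (Suc k) permutes {1..n}"
    using k by (intro permutes_swap_id) auto
  show v: "v permutes {1..n}"
    unfolding v_def by (rule permutes_compose[OF t u])
  have vk: "v k = u (Suc k)" "v (Suc k) = u k" by (simp_all add: v_def)
  have "v \<circ> Transposition.transpose k (Suc k) = u"
    by (simp add: v_def comp_assoc)
  with Inv_adjacent[OF v k] desc vk show "Inv n (inv u) = insert (u (Suc k), u k) (Inv n (inv v))"
    and "(u (Suc k), u k) \<notin> Inv n (inv v)" by auto
qed

text \<open>The descent pairs generate the inversion set. By induction on the distance of an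
  inverted pair, it is compared with the letter \<open>z\<close> just to the right of its left
  member. If \<open>z\<close> lies between the two values, transitivity of \<open>V\<close> applies;
  otherwise \<open>z\<close> forms a pair of \<open>V\<close> with one of them and a pair outside
  \<open>V\<close> with the other, and cotransitivity applies.\<close>

lemma Inv_subset_if_descents:
  assumes u: "u permutes {1..n}" and V: "biclosed n V" "V \<subseteq> Inv n (inv u)"
    and desc: "\<And>k. 1 \<le> k \<Longrightarrow> k < n \<Longrightarrow> u (Suc k) < u k \<Longrightarrow> (u (Suc k), u k) \<in> V"
  shows "Inv n (inv u) \<subseteq> V"
proof -
  have "(u (k + Suc d), u k) \<in> V" if "1 \<le> k" "k + Suc d \<le> n" "u (k + Suc d) < u k" for k d
    using that
  proof (induction d arbitrary: k)
    case 0
    then show ?case using desc[of k] by simp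
  next
    case (Suc d)
    define l z where "l = k + Suc (Suc d)" and "z = u (Suc k)"
    have ne: "z \<noteq> u k" "z \<noteq> u l"
      using permutes_inj[OF u] by (auto simp: z_def l_def inj_eq)
    have IH: "(u l, z) \<in> V" if "u l < z"
      using Suc.IH[of "Suc k"] Suc.prems that by (simp add: l_def z_def)
    have D: "(z, u k) \<in> V" if "z < u k"
      using desc[of k] Suc.prems that by (simp add: z_def)
    have nI: "(z, u l) \<notin> V" "(u k, z) \<notin> V"
      using V(2) by (auto simp: Inv_iff z_def l_def permutes_inverses[OF u])
    have "u l < u k" using Suc.prems by (simp add: l_def)
    then have "(u l, u k) \<in> V"
      using ne IH D nI biclosed_trans[OF V(1), of "u l" z "u k"]
        biclosed_cotrans[OF V(1), of "z" "u k" "u l"] biclosed_cotrans[OF V(1), of "u l" z "u k"]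
      by (metis linorder_neqE_nat less_trans)
    then show ?case by (simp add: l_def)
  qed
  note * = this
  show ?thesis
  proof
    fix e assume "e \<in> Inv n (inv u)"
    then obtain i j where e: "e = (i, j)" "1 \<le> i" "i < j" "j \<le> n" "inv u j < inv u i"
      by (cases e) (auto simp: Inv_iff)
    have r: "inv u j \<in> {1..n}" "inv u i \<in> {1..n}"
      unfolding permutes_in_image[OF permutes_inv[OF u]] using e by auto
    obtain d where d: "inv u i = inv u j + Suc d"
      using less_imp_Suc_add[OF e(5)] by auto
    have "u (inv u i) = i" "u (inv u j) = j" using permutes_inverses[OF u] by auto
    then show "e \<in> V" using *[of "inv u j" d] r e(1,3) unfolding d[symmetric] by simp
  qed
qed

text \<open>If the right-hand side \<open>V\<close> were smaller, some descent \<open>b a\<close> of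
  the join would have its pair missing from \<open>V\<close>. Removing this pair from the join
  leaves a biclosed \<open>C'\<close> containing \<open>X\<close>, so both \<open>Y\<close> and
  \<open>Z\<close> must contain the pair. It then lies in their meet as well, since no chain of
  pairs missed by \<open>Y\<close> or by \<open>Z\<close> leads from \<open>a\<close> to
  \<open>b\<close>.\<close>

lemma bijoin_semidistributive:
  assumes X: "biclosed n X" and Y: "biclosed n Y" and Z: "biclosed n Z"
    and eq: "bijoin X Y = bijoin X Z"
  shows "bijoin X Y = bijoin X (bimeet n Y Z)"
proof -
  define V where "V = bijoin X (bimeet n Y Z)"
  have V: "biclosed n V" unfolding V_def by (intro biclosed_bijoin biclosed_bimeet X Y Z)
  have C: "biclosed n (bijoin X Y)" by (intro biclosed_bijoin X Y)
  have VC: "V \<subseteq> bijoin X Y"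
    unfolding V_def using C bimeet_lower1[OF biclosed_subset[OF Y], of Z] bijoin_upper1[of X Y] bijoin_upper2[of Y X]
    by (intro bijoin_least) (auto simp: biclosed_def)
  obtain c' where c': "c' permutes {1..n}" "Inv n c' = bijoin X Y" by (rule biclosed_imp_Inv[OF C])
  define c where "c = inv c'"
  have c: "c permutes {1..n}" "Inv n (inv c) = bijoin X Y"
    unfolding c_def using c' by (auto simp: permutes_inv permutes_inv_inv)
  have "Inv n (inv c) \<subseteq> V"
  proof (rule Inv_subset_if_descents[OF c(1) V])
    show "V \<subseteq> Inv n (inv c)" using VC c by simp
    fix k assume k: "1 \<le> k" "k < n" "c (Suc k) < c k"
    define a b where "a = c (Suc k)" and "b = c k"
    define C' where "C' = Inv n (inv (c \<circ> Transposition.transpose k (Suc k)))"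
    have C': "biclosed n C'" unfolding C'_def by (rule biclosed_Inv)
    have CC': "Inv n (inv c) = insert (a, b) C'" "(a, b) \<notin> C'"
      using Inv_adjacent_descent[OF c(1) k] unfolding C'_def a_def b_def by auto
    show "(c (Suc k), c k) \<in> V"
    proof (rule ccontr)
      assume "(c (Suc k), c k) \<notin> V"
      then have nV: "(a, b) \<notin> V" by (simp add: a_def b_def)
      have XV: "X \<subseteq> V" and YZV: "bimeet n Y Z \<subseteq> V"
        unfolding V_def by (rule bijoin_upper1, rule bijoin_upper2)
      have YC: "Y \<subseteq> insert (a, b) C'" and ZC: "Z \<subseteq> insert (a, b) C'" and XC: "X \<subseteq> C'"
        using bijoin_upper2[of Y X] bijoin_upper2[of Z X] bijoin_upper1[of X Y] nV XV
        unfolding eq[symmetric] c(2)[symmetric] CC'(1) by blast+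
      have ab: "(a, b) \<in> bijoin X Y" using CC' c by auto
      have tC': "trans C'" using C' by (simp add: biclosed_def)
      have abY: "(a, b) \<in> Y" using bijoin_least[OF XC _ tC', of Y] YC ab CC' by blast
      have abZ: "(a, b) \<in> Z" using bijoin_least[OF XC _ tC', of Z] ZC ab CC' eq by blast
      have C'pos: "(i, j) \<in> insert (a, b) C' \<longleftrightarrow> 1 \<le> i \<and> i < j \<and> j \<le> n \<and> inv c j < inv c i" for i j
        using CC'(1) Inv_iff by metis
      have pos: "inv c a = Suc k" "inv c b = k"
        by (simp_all add: a_def b_def permutes_inverses[OF c(1)])
      text \<open>Going up from \<open>a\<close> along pairs outside \<open>Y\<close> or outside \<open>Z\<close>, one never leaves the
        values to the right of the adjacent pair \<open>b a\<close>.\<close>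
      have "(a, l) \<in> ((pairs n - Y) \<union> (pairs n - Z))\<^sup>+ \<Longrightarrow> l \<le> b \<Longrightarrow> l < b \<and> a < l \<and> Suc k < inv c l" for l
      proof (induction rule: trancl_induct)
        case (base l)
        have "a < l" using base by (auto simp: pairs_def)
        moreover have "l \<noteq> b" using base abY abZ by auto
        moreover have "Suc k < inv c l"
        proof (rule ccontr)
          \<comment> \<open>A letter \<open>l\<close> to the left of the pair is not inverted with
            \<open>b\<close>, so splitting \<open>(a, b)\<close> at \<open>l\<close> puts
            \<open>(a, l)\<close> into both \<open>Y\<close> and \<open>Z\<close>.\<close>
          assume nl: "\<not> Suc k < inv c l"
          then have "(l, b) \<notin> insert (a, b) C'"
            using pos C'pos[of l b] \<open>a < l\<close> \<open>l \<noteq> b\<close> permutes_inv_eq[OF c(1)]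
            by (metis Suc_lessI a_def less_irrefl)
          then have "(l, b) \<notin> Y" "(l, b) \<notin> Z" using YC ZC by auto
          then have "(a, l) \<in> Y" "(a, l) \<in> Z"
            using biclosed_cotrans[OF Y abY, of l] biclosed_cotrans[OF Z abZ, of l] \<open>a < l\<close> \<open>l \<noteq> b\<close> base by auto
          then show False using base by auto
        qed
        ultimately show ?case using base by auto
      next
        case (step l m)
        have lm: "l < m" "m \<le> n" using step by (auto simp: pairs_def)
        then have l: "l < b" "a < l" "Suc k < inv c l" using step by auto
        \<comment> \<open>A vertex \<open>l\<close> to the right of \<open>a\<close> is not inverted
          with \<open>a\<close>, so \<open>Y\<close> and \<open>Z\<close> both contain
          \<open>(l, b)\<close>: the next step of the chain cannot reach \<open>b\<close>.\<close>
        have "(a, l) \<notin> insert (a, b) C'" using l C'pos[of a l] pos by auto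
        then have al: "(a, l) \<notin> Y" "(a, l) \<notin> Z" using YC ZC by auto
        then have lb: "(l, b) \<in> Y" "(l, b) \<in> Z"
          using biclosed_cotrans[OF Y abY, of l] biclosed_cotrans[OF Z abZ, of l] l by auto
        have mb: "m \<noteq> b" using step lb by auto
        have "Suc k < inv c m"
        proof (rule ccontr)
          assume nl: "\<not> Suc k < inv c m"
          then have "(m, b) \<notin> insert (a, b) C'"
            using pos C'pos[of m b] l lm mb permutes_inv_eq[OF c(1)]
            by (metis Suc_lessI a_def less_trans not_less_iff_gr_or_eq)
          then have "(m, b) \<notin> Y" "(m, b) \<notin> Z" using YC ZC by auto
          then have "(a, m) \<in> Y" "(a, m) \<in> Z"
            using biclosed_cotrans[OF Y abY, of m] biclosed_cotrans[OF Z abZ, of m] l lm mb step by auto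
          then have "(l, m) \<in> Y" "(l, m) \<in> Z"
            using biclosed_cotrans[OF Y, of a m l] biclosed_cotrans[OF Z, of a m l] l lm al by auto
          then show False using step by auto
        qed
        then show ?case using mb l lm step by auto
      qed
      from this[of b] have "(a, b) \<in> bimeet n Y Z"
        using biclosed_subset[OF Y] abY unfolding bimeet_def bijoin_def by auto
      then show False using YZV nV by auto
    qed
  qed
  then show ?thesis using VC c(2) unfolding V_def by blast
qed

lemma bimeet_compl:
  "A \<subseteq> pairs n \<Longrightarrow> B \<subseteq> pairs n \<Longrightarrow> bimeet n (pairs n - A) (pairs n - B) = pairs n - bijoin A B"
  by (simp add: bimeet_def double_diff)

text \<open>Complementation in \<open>pairs n\<close> turns this into the join law.\<close>

lemma bimeet_semidistributive:
  assumes X: "biclosed n X" and Y: "biclosed n Y" and Z: "biclosed n Z"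
    and eq: "bimeet n X Y = bimeet n X Z"
  shows "bimeet n X Y = bimeet n X (bijoin Y Z)"
proof -
  let ?c = "\<lambda>A. pairs n - A"
  have cc: "biclosed n A \<Longrightarrow> ?c (?c A) = A" for A using biclosed_subset by blast
  have sub: "biclosed n (bijoin (?c X) (?c Y))" "biclosed n (bijoin (?c X) (?c Z))"
    by (intro biclosed_bijoin biclosed_compl X Y Z)+
  have "bijoin (?c X) (?c Y) = bijoin (?c X) (?c Z)"
    using eq cc[OF sub(1)] cc[OF sub(2)] unfolding bimeet_def by metis
  then have "bijoin (?c X) (?c Y) = bijoin (?c X) (bimeet n (?c Y) (?c Z))"
    by (intro bijoin_semidistributive biclosed_compl X Y Z)
  also have "bimeet n (?c Y) (?c Z) = ?c (bijoin Y Z)"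
    by (intro bimeet_compl biclosed_subset Y Z)
  finally show ?thesis unfolding bimeet_def by simp
qed

section \<open>Toggling in finite semidistributive lattices\<close>

lemma (in partial_order) covers_less:
  "covers L x y \<Longrightarrow> x \<in> carrier L \<and> y \<in> carrier L \<and> x \<sqsubseteq> y \<and> x \<noteq> y"
  by (auto simp: covers_def lless_def eq_is_equal)

lemma (in partial_order) covers_between:
  "covers L x y \<Longrightarrow> z \<in> carrier L \<Longrightarrow> x \<sqsubseteq> z \<Longrightarrow> z \<sqsubseteq> y \<Longrightarrow> z = x \<or> z = y"
  by (auto simp: covers_def lless_def eq_is_equal)

lemma (in lattice) join_eq_right: "x \<in> carrier L \<Longrightarrow> y \<in> carrier L \<Longrightarrow> x \<sqsubseteq> y \<Longrightarrow> x \<squnion> y = y"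
  by (meson join_le join_right le_refl join_closed le_antisym)

context finite_semidistributive_lattice
begin

text \<open>The set contains \<open>y\<close>, and join semidistributivity closes it under binary
  meets; being finite, it has a least element. This justifies the definite description in
  \<open>cover_label\<close>.\<close>

lemma cover_label_least:
  assumes c: "covers L x y"
  shows "least L (cover_label L x y) {z \<in> carrier L. x \<squnion> z = y}"
proof -
  let ?S = "{z \<in> carrier L. x \<squnion> z = y}"
  have xy: "x \<in> carrier L" "y \<in> carrier L" "x \<sqsubseteq> y" using covers_less[OF c] by auto
  have y: "y \<in> ?S" using xy join_eq_right by simp
  have "\<exists>m\<in>?S. \<forall>z\<in>F. m \<sqsubseteq> z" if "finite F" "F \<subseteq> ?S" for F
    using that
  proof induction
    case empty
    then show ?case using y by blast
  next
    case (insert a F)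
    then obtain m where m: "m \<in> ?S" "\<forall>z\<in>F. m \<sqsubseteq> z" by auto
    have a: "a \<in> ?S" using insert by auto
    have "x \<squnion> m = x \<squnion> (m \<sqinter> a)"
      using m a xy by (intro join_semidistributive) auto
    then have "m \<sqinter> a \<in> ?S" using m a by auto
    moreover have "m \<sqinter> a \<sqsubseteq> z" if "z \<in> insert a F" for z
    proof -
      have "m \<sqinter> a \<sqsubseteq> m" "m \<sqinter> a \<sqsubseteq> a" using m a by (auto intro: meet_left meet_right)
      moreover have "z \<in> carrier L" using that insert by auto
      ultimately show ?thesis using that m a by (auto intro: le_trans)
    qed
    ultimately show ?case by blast
  qed
  from this[of ?S] obtain m where m: "least L m ?S"
    using finite_carrier unfolding least_def by auto
  moreover have "p = m" if "least L p ?S" for p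
    using that m by (auto simp: least_def intro: le_antisym)
  ultimately show ?thesis unfolding cover_label_def by (rule theI)
qed

lemma cover_label_closed: "covers L x y \<Longrightarrow> cover_label L x y \<in> carrier L"
  and join_cover_label: "covers L x y \<Longrightarrow> x \<squnion> cover_label L x y = y"
  using cover_label_least[of x y] by (auto simp: least_def)

lemma cover_label_le: "covers L x y \<Longrightarrow> z \<in> carrier L \<Longrightarrow> x \<squnion> z = y \<Longrightarrow> cover_label L x y \<sqsubseteq> z"
  using cover_label_least[of x y] by (auto simp: least_def)

lemma cover_label_le_top: "covers L x y \<Longrightarrow> cover_label L x y \<sqsubseteq> y"
  by (metis cover_label_closed join_cover_label join_right covers_less)

text \<open>By minimality of the label, the join of \<open>x\<close> and \<open>z\<close> lies
  strictly below \<open>y\<close>, and the cover relation leaves only \<open>x\<close>.\<close>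

lemma cover_label_strict_lower:
  assumes c: "covers L x y" and z: "z \<in> carrier L" "z \<sqsubseteq> cover_label L x y" "z \<noteq> cover_label L x y"
  shows "z \<sqsubseteq> x"
proof -
  note p = cover_label_closed[OF c] and xy = covers_less[OF c]
  have "x \<squnion> z \<sqsubseteq> y"
    using xy p z cover_label_le_top[OF c] by (intro join_le) (auto intro: le_trans)
  moreover have "x \<squnion> z \<noteq> y"
    using cover_label_le[OF c z(1)] z p by (auto dest: le_antisym)
  ultimately have "x \<squnion> z = x"
    using covers_between[OF c, of "x \<squnion> z"] xy z by (auto intro: join_left)
  then show ?thesis using join_right[of x z] xy z by simp
qed

lemma cover_label_not_le: "covers L x y \<Longrightarrow> \<not> cover_label L x y \<sqsubseteq> x"
  by (metis cover_label_closed join_cover_label join_eq_right join_comm covers_less)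

text \<open>Two elements strictly below the label both lie below \<open>x\<close>, hence so does
  their join, whereas the label does not.\<close>

lemma cover_label_irreducible:
  assumes c: "covers L x y"
  shows "cover_label L x y \<in> join_irreducibles L"
proof -
  let ?p = "cover_label L x y"
  note p = cover_label_closed[OF c] and xy = covers_less[OF c]
  have "\<not> least L ?p (carrier L)"
    using cover_label_not_le[OF c] xy by (auto simp: least_def)
  moreover have "?p = a \<or> ?p = b" if "a \<in> carrier L" "b \<in> carrier L" "?p = a \<squnion> b" for a b
  proof (rule ccontr)
    assume "\<not> ?thesis"
    moreover have "a \<sqsubseteq> ?p" "b \<sqsubseteq> ?p" using that by (auto intro: join_left join_right)
    ultimately have "a \<sqsubseteq> x" "b \<sqsubseteq> x"
      using cover_label_strict_lower[OF c] that by auto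
    then have "?p \<sqsubseteq> x" using that xy by (auto intro: join_le)
    then show False using cover_label_not_le[OF c] by simp
  qed
  ultimately show ?thesis using p by (auto simp: join_irreducibles_def)
qed

lemma cover_label_inj_upper:
  "covers L y z \<Longrightarrow> covers L y z' \<Longrightarrow> cover_label L y z = cover_label L y z' \<Longrightarrow> z = z'"
  by (metis join_cover_label)

text \<open>Everything strictly below the common label lies below both \<open>x\<close> and
  \<open>x'\<close>, so these have the same meet with the label. If they differed, their join would
  be \<open>y\<close>, and meet semidistributivity would place the label below
  \<open>x\<close>.\<close>

lemma cover_label_inj_lower:
  assumes c: "covers L x y" and c': "covers L x' y" and eq: "cover_label L x y = cover_label L x' y"
  shows "x = x'"
proof (rule ccontr)
  assume ne: "x \<noteq> x'"
  let ?p = "cover_label L x y"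
  note p = cover_label_closed[OF c] and xy = covers_less[OF c] and xy' = covers_less[OF c']
  have meets: "?p \<sqinter> x = ?p \<sqinter> x'"
  proof (rule le_antisym)
    have pc: "?p \<sqinter> x \<in> carrier L" "?p \<sqinter> x' \<in> carrier L" using p xy xy' by auto
    have "?p \<sqinter> x \<sqsubseteq> x'" 
    proof (rule cover_label_strict_lower[OF c', folded eq])
      show "?p \<sqinter> x \<noteq> ?p"
        using meet_right[of ?p x] cover_label_not_le[OF c] p xy by auto
    qed (use pc p xy in \<open>auto intro: meet_left\<close>)
    then show "?p \<sqinter> x \<sqsubseteq> ?p \<sqinter> x'" using pc p xy xy' by (auto intro: meet_le meet_left)
    have "?p \<sqinter> x' \<sqsubseteq> x" 
    proof (rule cover_label_strict_lower[OF c])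
      show "?p \<sqinter> x' \<noteq> ?p"
        using meet_right[of ?p x'] cover_label_not_le[OF c', folded eq] p xy' by auto
    qed (use pc p xy' in \<open>auto intro: meet_left\<close>)
    then show "?p \<sqinter> x' \<sqsubseteq> ?p \<sqinter> x" using pc p xy xy' by (auto intro: meet_le meet_left)
  qed (use p xy xy' in auto)
  have xx': "x \<squnion> x' \<sqsubseteq> y" "x \<sqsubseteq> x \<squnion> x'" "x' \<sqsubseteq> x \<squnion> x'" "x \<squnion> x' \<in> carrier L"
    using xy xy' by (auto intro: join_le join_left join_right)
  have "x \<squnion> x' \<noteq> x"
    using xx' covers_between[OF c', of x] xy xy' ne by auto
  then have "x \<squnion> x' = y" using covers_between[OF c xx'(4,2,1)] by simp
  moreover have "?p \<sqinter> x = ?p \<sqinter> (x \<squnion> x')"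
    using meet_semidistributive[OF p _ _ meets] xy xy' by simp
  moreover have "?p \<sqinter> y = ?p"
    using le_iff_join[OF p, of y] cover_label_le_top[OF c] xy by simp
  ultimately show False
    using meet_right[of ?p x] cover_label_not_le[OF c] p xy by auto
qed

section \<open>Toggle sums and toggle-symmetric expectations\<close>

lemma finite_covers [simp]: "finite {x. covers L x y}" "finite {z. covers L y z}"
  using finite_carrier by (auto intro: rev_finite_subset simp: covers_def)

lemma finite_join_irreducibles [simp]: "finite (join_irreducibles L)"
  using finite_carrier by (auto intro: rev_finite_subset simp: join_irreducibles_def)

text \<open>Distinct upper covers of \<open>y\<close> have distinct labels, so each nonzero toggle
  corresponds to exactly one cover.\<close>

lemma sum_toggle_in:
  fixes h :: "'a \<Rightarrow> real"
  shows "(\<Sum>p\<in>join_irreducibles L. h p * toggle_in L p y) = (\<Sum>z | covers L y z. h (cover_label L y z))"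
proof -
  let ?l = "cover_label L y" and ?C = "{z. covers L y z}"
  have "(\<Sum>p\<in>join_irreducibles L. h p * toggle_in L p y)
      = (\<Sum>p\<in>join_irreducibles L. if p \<in> ?l ` ?C then h p else 0)"
    by (rule sum.cong) (auto simp: toggle_in_def)
  also have "\<dots> = sum h (?l ` ?C)"
    by (rule sum.mono_neutral_cong_right) (auto simp: cover_label_irreducible)
  also have "\<dots> = (\<Sum>z\<in>?C. h (?l z))"
    by (rule sum.reindex_cong) (auto intro: inj_onI cover_label_inj_upper)
  finally show ?thesis .
qed

lemma sum_toggle_out:
  fixes h :: "'a \<Rightarrow> real"
  shows "(\<Sum>p\<in>join_irreducibles L. h p * toggle_out L p y) = (\<Sum>x | covers L x y. h (cover_label L x y))"
proof -
  let ?l = "\<lambda>x. cover_label L x y" and ?C = "{x. covers L x y}"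
  have "(\<Sum>p\<in>join_irreducibles L. h p * toggle_out L p y)
      = (\<Sum>p\<in>join_irreducibles L. if p \<in> ?l ` ?C then h p else 0)"
    by (rule sum.cong) (auto simp: toggle_out_def)
  also have "\<dots> = sum h (?l ` ?C)"
    by (rule sum.mono_neutral_cong_right) (auto simp: cover_label_irreducible)
  also have "\<dots> = (\<Sum>x\<in>?C. h (?l x))"
    by (rule sum.reindex_cong) (auto intro: inj_onI cover_label_inj_lower)
  finally show ?thesis .
qed

text \<open>Every edge labelled \<open>p\<close> has one lower and one upper end, and injectivity of
  labels on both sides makes the lower ends, and likewise the upper ends, of distinct such edges
  distinct.\<close>

lemma toggle_symmetric_uniform: "toggle_symmetric L (pmf_of_set (carrier L))"
proof -
  have "(\<Sum>y\<in>carrier L. toggleability L p y) = 0" for p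
  proof -
    let ?C = "{(x, y). covers L x y \<and> cover_label L x y = p}"
    have "card (fst ` ?C) = card ?C"
      by (rule card_image) (auto intro!: inj_onI dest: cover_label_inj_upper)
    moreover have "card (snd ` ?C) = card ?C"
      by (rule card_image) (auto intro!: inj_onI dest: cover_label_inj_lower)
    moreover have "(\<Sum>y\<in>carrier L. toggle_in L p y) = card (fst ` ?C)"
    proof -
      have "y \<in> fst ` ?C \<longleftrightarrow> (\<exists>z. covers L y z \<and> cover_label L y z = p)" for y unfolding image_iff by auto
      then have "(\<Sum>y\<in>carrier L. toggle_in L p y) = (\<Sum>y\<in>carrier L. if y \<in> fst ` ?C then 1 else 0)"
        by (intro sum.cong) (simp_all add: toggle_in_def)
      also have "\<dots> = (\<Sum>y\<in>fst ` ?C. 1)"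
        using finite_carrier by (intro sum.mono_neutral_cong_right) (auto dest: covers_less)
      finally show ?thesis by simp
    qed
    moreover have "(\<Sum>y\<in>carrier L. toggle_out L p y) = card (snd ` ?C)"
    proof -
      have "y \<in> snd ` ?C \<longleftrightarrow> (\<exists>z. covers L z y \<and> cover_label L z y = p)" for y unfolding image_iff by auto
      then have "(\<Sum>y\<in>carrier L. toggle_out L p y) = (\<Sum>y\<in>carrier L. if y \<in> snd ` ?C then 1 else 0)"
        by (intro sum.cong) (simp_all add: toggle_out_def)
      also have "\<dots> = (\<Sum>y\<in>snd ` ?C. 1)"
        using finite_carrier by (intro sum.mono_neutral_cong_right) (auto dest: covers_less)
      finally show ?thesis by simp
    qed
    ultimately show ?thesis by (simp add: toggleability_def sum_subtractf)
  qed
  then show ?thesis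
    using finite_carrier carrier_nonempty
    by (simp add: toggle_symmetric_def integral_pmf_of_set)
qed

text \<open>Toggle symmetry lets upward toggles be traded for downward ones.\<close>

lemma expectation_ddeg:
  fixes f g :: "'a \<Rightarrow> real"
  assumes \<mu>: "toggle_symmetric L \<mu>"
    and const: "\<And>y. y \<in> carrier L \<Longrightarrow>
      (\<Sum>z | covers L y z. f (cover_label L y z)) + (\<Sum>x | covers L x y. g (cover_label L x y)) = N"
    and fg: "\<And>x y. covers L x y \<Longrightarrow> f (cover_label L x y) + g (cover_label L x y) = c"
  shows "c * measure_pmf.expectation \<mu> (\<lambda>y. real (ddeg L y)) = N"
proof -
  have sub: "set_pmf \<mu> \<subseteq> carrier L" using \<mu> by (simp add: toggle_symmetric_def)
  then have int [simp]: "integrable \<mu> h" for h :: "'a \<Rightarrow> real"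
    using finite_carrier finite_subset by (intro integrable_measure_pmf_finite) blast
  let ?J = "join_irreducibles L"
  \<comment> \<open>On labels of lower covers \<open>g\<close> equals \<open>c - f\<close>: the
    \<open>f\<close> part combines with the upward sum into toggleabilities, and \<open>c\<close> is
    counted \<open>ddeg\<close> times.\<close>
  have "N = (\<Sum>p\<in>?J. f p * toggleability L p y) + c * real (ddeg L y)" if "y \<in> carrier L" for y
  proof -
    have "c * real (ddeg L y) = (\<Sum>x | covers L x y. f (cover_label L x y) + g (cover_label L x y))"
      by (simp add: ddeg_def fg)
    then show ?thesis
      using const[OF that] sum_toggle_in[of f y] sum_toggle_out[of f y]
      by (simp add: toggleability_def right_diff_distrib sum_subtractf sum.distrib)
  qed
  then have "measure_pmf.expectation \<mu> (\<lambda>_. N)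
      = measure_pmf.expectation \<mu> (\<lambda>y. (\<Sum>p\<in>?J. f p * toggleability L p y) + c * real (ddeg L y))"
    using sub by (intro integral_cong_AE) (auto simp: AE_measure_pmf_iff)
  also have "\<dots> = (\<Sum>p\<in>?J. f p * measure_pmf.expectation \<mu> (toggleability L p))
      + c * measure_pmf.expectation \<mu> (\<lambda>y. real (ddeg L y))"
    by simp
  also have "\<dots> = c * measure_pmf.expectation \<mu> (\<lambda>y. real (ddeg L y))"
    using \<mu> by (simp add: toggle_symmetric_def)
  finally show ?thesis by simp
qed

text \<open>The uniform distribution is itself toggle-symmetric, so the value forced on all these
  expectations is the edge density.\<close>

lemma tCDE_edge_densityI:
  fixes f g :: "'a \<Rightarrow> real"
  assumes const: "\<And>y. y \<in> carrier L \<Longrightarrow>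
      (\<Sum>z | covers L y z. f (cover_label L y z)) + (\<Sum>x | covers L x y. g (cover_label L x y)) = N"
    and fg: "\<And>x y. covers L x y \<Longrightarrow> f (cover_label L x y) + g (cover_label L x y) = c"
    and c: "c \<noteq> 0"
  shows "tCDE L \<and> edge_density L = N / c"
proof -
  have *: "measure_pmf.expectation \<mu> (\<lambda>y. real (ddeg L y)) = N / c" if "toggle_symmetric L \<mu>" for \<mu>
    using expectation_ddeg[OF that const fg] c by (simp add: field_simps)
  then show ?thesis
    using *[OF toggle_symmetric_uniform] finite_semidistributive_lattice_axioms
    by (simp add: tCDE_def edge_density_def)
qed

end

section \<open>Balanced shapes\<close>

lemma mem_young_diagram: "(x, y) \<in> young_diagram p \<longleftrightarrow> 1 \<le> x \<and> 1 \<le> y \<and> y \<le> int (p (nat x))"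
proof
  assume *: "1 \<le> x \<and> 1 \<le> y \<and> y \<le> int (p (nat x))"
  then have "x = int (nat x)" "y = int (nat y)" "1 \<le> nat x" "1 \<le> nat y" "nat y \<le> p (nat x)" by auto
  then show "(x, y) \<in> young_diagram p" unfolding young_diagram_def by blast
qed (auto simp: young_diagram_def)

lemma mem_skew_diagram:
  "(x, y) \<in> skew_diagram lam nu \<longleftrightarrow> 1 \<le> x \<and> int (nu (nat x)) < y \<and> y \<le> int (lam (nat x))"
  by (auto simp: skew_diagram_def mem_young_diagram)

lemma mem_translate: "(r, s) \<in> translate d D \<longleftrightarrow> (r - fst d, s - snd d) \<in> D"
  by (force simp: translate_def image_iff)

lemma mem_rectangle: "(r, s) \<in> rectangle a b \<longleftrightarrow> 1 \<le> r \<and> r \<le> int a \<and> 1 \<le> s \<and> s \<le> int b"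
  by (auto simp: rectangle_def)

lemma is_partition_antimono:
  assumes "is_partition p" "1 \<le> x" "x \<le> y"
  shows "p y \<le> p x"
  using assms(3)
proof (induction rule: dec_induct)
  case (step m)
  then show ?case using assms(1,2) unfolding is_partition_def by (meson le_trans)
qed simp

text \<open>Row \<open>r\<close> occupies the columns from \<open>N r + 1\<close> to
  \<open>L r\<close>. \<open>overlap\<close> is what connectedness yields, a column common to
  consecutive rows; \<open>L_first\<close> and \<open>N_last\<close> make the shape reach the
  northeast and southwest corners of the rectangle.\<close>

locale balanced_rows =
  fixes D :: diagram and a b :: nat and N L :: "int \<Rightarrow> int"
  assumes D_eq: "D = {(r, s). 1 \<le> r \<and> r \<le> int a \<and> N r < s \<and> s \<le> L r}"
    and N_antimono: "1 \<le> r \<Longrightarrow> r \<le> r' \<Longrightarrow> r' \<le> int a \<Longrightarrow> N r' \<le> N r"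
    and L_antimono: "1 \<le> r \<Longrightarrow> r \<le> r' \<Longrightarrow> r' \<le> int a \<Longrightarrow> L r' \<le> L r"
    and overlap: "1 \<le> r \<Longrightarrow> r < int a \<Longrightarrow> N r < L (r + 1)"
    and L_first: "L 1 = int b"
    and N_last: "N (int a) = 0"
    and corners: "outward_corner D p q \<Longrightarrow> on_main_antidiagonal a b p q"
begin

text \<open>A discrete intermediate value argument, used to find the consecutive rows between which
  a boundary falls past column \<open>j\<close>.\<close>

lemma int_drop:
  fixes h :: "int \<Rightarrow> int"
  assumes "r0 \<le> r1" "h r1 < j" "j \<le> h r0"
  obtains r where "r0 \<le> r" "r < r1" "h (r + 1) < j" "j \<le> h r"
proof -
  have "j \<le> h r0 \<longrightarrow> h r1 < j \<longrightarrow> (\<exists>r. r0 \<le> r \<and> r < r1 \<and> h (r + 1) < j \<and> j \<le> h r)"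
    using assms(1)
  proof (induction rule: int_ge_induct)
    case (step i)
    then show ?case by (cases "h i < j") force+
  qed simp
  then show ?thesis using assms that by blast
qed

text \<open>Where the right boundary drops past column \<open>j\<close>, \<open>overlap\<close>
  makes three of the squares around the turning point boxes, and only the southeast one is missing;
  so this is an outward corner.\<close>

lemma L_corner:
  assumes r: "1 \<le> r0" "r0 \<le> r1" "r1 \<le> int a" and j: "L r1 < j" "j \<le> L r0"
  obtains p q where "r0 \<le> p" "p < r1" "L r1 \<le> q" "q < j" "on_main_antidiagonal a b p q"
proof -
  obtain p where p: "r0 \<le> p" "p < r1" "L (p + 1) < j" "j \<le> L p"
    using int_drop[OF r(2) j] .
  let ?q = "L (p + 1)"
  have "N p < ?q" "N (p + 1) \<le> N p" using p r overlap[of p] N_antimono[of p "p + 1"] by auto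
  then have "D \<inter> {(p, ?q), (p, ?q + 1), (p + 1, ?q), (p + 1, ?q + 1)} = {(p, ?q), (p, ?q + 1), (p + 1, ?q)}"
    using p r by (auto simp: D_eq)
  then have "outward_corner D p ?q" by (simp add: outward_corner_def)
  moreover have "L r1 \<le> ?q" using L_antimono[of "p + 1" r1] p r by auto
  ultimately show ?thesis using that p corners by blast
qed

text \<open>On the left boundary the missing square is the northwest one.\<close>

lemma N_corner:
  assumes r: "1 \<le> r0" "r0 \<le> r1" "r1 \<le> int a" and j: "N r1 < j" "j \<le> N r0"
  obtains p q where "r0 \<le> p" "p < r1" "j \<le> q" "q \<le> N r0" "on_main_antidiagonal a b p q"
proof -
  obtain p where p: "r0 \<le> p" "p < r1" "N (p + 1) < j" "j \<le> N p"
    using int_drop[OF r(2) j] .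
  let ?q = "N p"
  have "?q < L (p + 1)" "L (p + 1) \<le> L p" using p r overlap[of p] L_antimono[of p "p + 1"] by auto
  then have "D \<inter> {(p, ?q), (p, ?q + 1), (p + 1, ?q), (p + 1, ?q + 1)} = {(p, ?q + 1), (p + 1, ?q), (p + 1, ?q + 1)}"
    using p r by (auto simp: D_eq)
  then have "outward_corner D p ?q" by (simp add: outward_corner_def)
  moreover have "?q \<le> N r0" using N_antimono[of r0 p] p r by auto
  ultimately show ?thesis using that p corners by blast
qed

end

text \<open>The boxes met by the main antidiagonal, each listed with multiplicity proportional to
  the part of the antidiagonal inside it.\<close>

definition diag_row :: "nat \<Rightarrow> nat \<Rightarrow> nat \<Rightarrow> int" where
  "diag_row a b t = int a - int (t div b)"

definition diag_col :: "nat \<Rightarrow> nat \<Rightarrow> int" where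
  "diag_col a t = int (t div a) + 1"

text \<open>The antidiagonal passes through the interior of the box with index \<open>t\<close>, so
  the northwest vertex of that box, and every point weakly northwest of it, lies strictly on the
  northwest side.\<close>

lemma diag_not_southeast:
  assumes a: "0 < a" and b: "0 < b" and pq: "p < diag_row a b t" "q < diag_col a t"
  shows "\<not> on_main_antidiagonal a b p q"
proof
  assume "on_main_antidiagonal a b p q"
  then have eq: "p * int b + q * int a = int a * int b" by (simp add: on_main_antidiagonal_def)
  let ?m = "int (t div b)" and ?k = "int (t div a)"
  have "int t < (?m + 1) * int b"
    using dividend_less_div_times[OF b, of t] by (simp add: algebra_simps flip: of_nat_mult of_nat_add)
  moreover have "?k * int a \<le> int t"
    by (simp flip: of_nat_mult)
  moreover have "q * int a \<le> ?k * int a" "p * int b \<le> (int a - ?m - 1) * int b"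
    using pq by (auto simp: diag_row_def diag_col_def intro!: mult_right_mono)
  ultimately show False using eq by (simp add: algebra_simps)
qed

text \<open>Likewise the southeast vertex of the box lies strictly southeast of the
  antidiagonal.\<close>

lemma diag_not_northwest:
  assumes a: "0 < a" and b: "0 < b" and pq: "diag_row a b t \<le> p" "diag_col a t \<le> q"
  shows "\<not> on_main_antidiagonal a b p q"
proof
  assume "on_main_antidiagonal a b p q"
  then have eq: "p * int b + q * int a = int a * int b" by (simp add: on_main_antidiagonal_def)
  let ?m = "int (t div b)" and ?k = "int (t div a)"
  have "int t < (?k + 1) * int a"
    using dividend_less_div_times[OF a, of t] by (simp add: algebra_simps flip: of_nat_mult of_nat_add)
  moreover have "?m * int b \<le> int t"
    by (simp flip: of_nat_mult)
  moreover have "(?k + 1) * int a \<le> q * int a" "(int a - ?m) * int b \<le> p * int b"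
    using pq by (auto simp: diag_row_def diag_col_def intro!: mult_right_mono)
  ultimately show False using eq by (simp add: algebra_simps)
qed

section \<open>Multiplicities of the antidiagonal boxes in each row and column\<close>

lemma div_eq_iff_between:
  fixes t m b :: nat
  assumes "b \<noteq> 0"
  shows "t div b = m \<longleftrightarrow> m * b \<le> t \<and> t < m * b + b"
proof
  assume "t div b = m"
  then show "m * b \<le> t \<and> t < m * b + b"
    using assms dividend_less_div_times[of b t] by (auto simp: add.commute)
next
  assume "m * b \<le> t \<and> t < m * b + b"
  then show "t div b = m" by (intro div_nat_eqI) (simp_all add: mult.commute)
qed

text \<open>A row receives the \<open>b\<close> consecutive indices \<open>t\<close> that share one
  quotient \<open>t div b\<close>.\<close>

lemma card_diag_row:
  assumes "1 \<le> r" "r \<le> int a"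
  shows "card {t \<in> {..<a * b}. diag_row a b t = r} = b"
proof (cases "b = 0")
  case False
  define m where "m = nat (int a - r)"
  have m: "m < a" "int m = int a - r" using assms by (auto simp: m_def)
  have "m * b + b \<le> a * b" using m mult_le_mono1[of "Suc m" a b] by simp
  moreover have "diag_row a b t = r \<longleftrightarrow> m * b \<le> t \<and> t < m * b + b" for t
    using m(2) unfolding diag_row_def div_eq_iff_between[OF False, symmetric] by linarith
  moreover have "t < a * b" if "t < m * b + b" for t
    by (rule less_le_trans[OF that]) fact
  ultimately have "{t \<in> {..<a * b}. diag_row a b t = r} = {t. m * b \<le> t \<and> t < m * b + b}"
    unfolding lessThan_iff by blast
  also have "\<dots> = {m * b..<m * b + b}" by (simp add: set_eq_iff)
  finally have "{t \<in> {..<a * b}. diag_row a b t = r} = {m * b..<m * b + b}" .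
  then show ?thesis by simp
qed simp

lemma card_diag_col:
  assumes "1 \<le> s" "s \<le> int b"
  shows "card {t \<in> {..<a * b}. diag_col a t = s} = a"
proof (cases "a = 0")
  case False
  define m where "m = nat (s - 1)"
  have m: "m < b" "int m = s - 1" using assms by (auto simp: m_def)
  have "m * a + a \<le> a * b" using m mult_le_mono1[of "Suc m" b a] by (simp add: mult.commute)
  moreover have "diag_col a t = s \<longleftrightarrow> m * a \<le> t \<and> t < m * a + a" for t
    using m(2) unfolding diag_col_def div_eq_iff_between[OF False, symmetric] by linarith
  moreover have "t < a * b" if "t < m * a + a" for t
    by (rule less_le_trans[OF that]) fact
  ultimately have "{t \<in> {..<a * b}. diag_col a t = s} = {t. m * a \<le> t \<and> t < m * a + a}"
    unfolding lessThan_iff by blast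
  also have "\<dots> = {m * a..<m * a + a}" by (simp add: set_eq_iff)
  finally have "{t \<in> {..<a * b}. diag_col a t = s} = {m * a..<m * a + a}" .
  then show ?thesis by simp
qed simp

context balanced_rows
begin

text \<open>If the box lay beyond the right boundary, that boundary, which starts at column
  \<open>b\<close> in row 1, would have an outward corner northwest of the box; beyond the left
  boundary there would be one to the southeast. Neither can lie on the antidiagonal.\<close>

lemma diag_in_shape:
  assumes t: "t < a * b"
  shows "(diag_row a b t, diag_col a t) \<in> D"
proof (rule ccontr)
  let ?i = "diag_row a b t" and ?j = "diag_col a t"
  have ab: "0 < a" "0 < b" using t by (auto intro: Nat.gr0I)
  have "t div b < a" "t div a < b" using t ab by (auto simp: div_less_iff_less_mult mult.commute)
  then have ij: "1 \<le> ?i" "?i \<le> int a" "1 \<le> ?j" "?j \<le> int b"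
    by (auto simp: diag_row_def diag_col_def)
  assume "(?i, ?j) \<notin> D"
  then consider "L ?i < ?j" | "?j \<le> N ?i" using ij by (auto simp: D_eq)
  then show False
  proof cases
    case 1
    then show False
      using L_corner[of 1 ?i ?j] ij L_first diag_not_southeast[OF ab] by auto
  next
    case 2
    then show False
      using N_corner[of ?i "int a" ?j] ij N_last diag_not_northwest[OF ab] by auto
  qed
qed

text \<open>A missing \<open>(i', j')\<close> forces a boundary to turn between rows
  \<open>i'\<close> and \<open>diag_row a b t\<close>: at an outward corner southeast of the
  antidiagonal box if row \<open>i'\<close> ends too early, and northwest of it if row
  \<open>i'\<close> starts too late.\<close>

lemma diag_rectangle_closed:
  assumes t: "t < a * b" and D: "(i', diag_col a t) \<in> D" "(diag_row a b t, j') \<in> D"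
  shows "(i', j') \<in> D"
proof (rule ccontr)
  let ?i = "diag_row a b t" and ?j = "diag_col a t"
  have ab: "0 < a" "0 < b" using t by (auto intro: Nat.gr0I)
  have *: "1 \<le> i'" "i' \<le> int a" "N i' < ?j" "?j \<le> L i'" "1 \<le> ?i" "?i \<le> int a" "N ?i < j'" "j' \<le> L ?i"
    using D by (auto simp: D_eq)
  assume "(i', j') \<notin> D"
  then consider "L i' < j'" | "j' \<le> N i'" using * by (auto simp: D_eq)
  then show False
  proof cases
    case 1
    then have "?i \<le> i'" using L_antimono[of i' ?i] * by force
    then obtain p q where "?i \<le> p" "L i' \<le> q" "on_main_antidiagonal a b p q"
      using L_corner[of ?i i' j'] 1 * by metis
    then show False using diag_not_northwest[OF ab, of t p q] * by auto
  next
    case 2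
    then have "i' \<le> ?i" using N_antimono[of ?i i'] * by force
    then obtain p q where "p < ?i" "q \<le> N i'" "on_main_antidiagonal a b p q"
      using N_corner[of i' ?i j'] 2 * by metis
    then show False using diag_not_southeast[OF ab, of p t q] * by auto
  qed
qed

end

text \<open>An empty outermost row or column would let the shape fit into a smaller rectangle, after
  a shift by one if it is the first.\<close>

lemma has_height_width_extremes:
  assumes hw: "has_height_width D a b" and D: "D \<noteq> {}" and sub: "translate d D \<subseteq> rectangle a b"
  obtains s1 s2 r1 r2 where "(1, s1) \<in> translate d D" "(int a, s2) \<in> translate d D"
    "(r1, 1) \<in> translate d D" "(r2, int b) \<in> translate d D"
proof -
  have min: "\<And>a' b' d. translate d D \<subseteq> rectangle a' b' \<Longrightarrow> a \<le> a' \<and> b \<le> b'"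
    using hw unfolding has_height_width_def by blast
  obtain x y where "(x, y) \<in> D" using D by fastforce
  then have "(x + fst d, y + snd d) \<in> translate d D" by (simp add: mem_translate)
  then have ab: "0 < a" "0 < b" using sub mem_rectangle by force+
  have in_rect: "(r, s) \<in> translate d D \<Longrightarrow> 1 \<le> r \<and> r \<le> int a \<and> 1 \<le> s \<and> s \<le> int b" for r s
    using sub mem_rectangle by blast
  have "\<exists>s. (1, s) \<in> translate d D"
  proof (rule ccontr)
    assume none: "\<not> ?thesis"
    have "translate (fst d - 1, snd d) D \<subseteq> rectangle (a - 1) b"
    proof (rule subrelI)
      fix r s assume "(r, s) \<in> translate (fst d - 1, snd d) D"
      then have "(r + 1, s) \<in> translate d D" by (simp add: mem_translate algebra_simps)
      with none in_rect[OF this] ab show "(r, s) \<in> rectangle (a - 1) b"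
        by (cases "r = 0") (auto simp: mem_rectangle)
    qed
    then show False using min ab by fastforce
  qed
  moreover have "\<exists>s. (int a, s) \<in> translate d D"
  proof (rule ccontr)
    assume none: "\<not> ?thesis"
    have "translate d D \<subseteq> rectangle (a - 1) b"
    proof (rule subrelI)
      fix r s assume "(r, s) \<in> translate d D"
      with none in_rect[OF this] ab show "(r, s) \<in> rectangle (a - 1) b"
        by (cases "r = int a") (auto simp: mem_rectangle)
    qed
    then show False using min ab by fastforce
  qed
  moreover have "\<exists>r. (r, 1) \<in> translate d D"
  proof (rule ccontr)
    assume none: "\<not> ?thesis"
    have "translate (fst d, snd d - 1) D \<subseteq> rectangle a (b - 1)"
    proof (rule subrelI)
      fix r s assume "(r, s) \<in> translate (fst d, snd d - 1) D"
      then have "(r, s + 1) \<in> translate d D" by (simp add: mem_translate algebra_simps)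
      with none in_rect[OF this] ab show "(r, s) \<in> rectangle a (b - 1)"
        by (cases "s = 0") (auto simp: mem_rectangle)
    qed
    then show False using min ab by fastforce
  qed
  moreover have "\<exists>r. (r, int b) \<in> translate d D"
  proof (rule ccontr)
    assume none: "\<not> ?thesis"
    have "translate d D \<subseteq> rectangle a (b - 1)"
    proof (rule subrelI)
      fix r s assume "(r, s) \<in> translate d D"
      with none in_rect[OF this] ab show "(r, s) \<in> rectangle a (b - 1)"
        by (cases "s = int b") (auto simp: mem_rectangle)
    qed
    then show False using min ab by fastforce
  qed
  ultimately show ?thesis using that by blast
qed

section \<open>Row description of a balanced skew shape\<close>

lemma equivclp_invariant:
  assumes "equivclp R x y" "\<And>u v. R u v \<Longrightarrow> P u \<longleftrightarrow> P v"
  shows "P x \<longleftrightarrow> P y"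
  using assms(1)
proof (induction rule: equivclp_induct)
  case (step y z)
  then show ?case using assms(2) by blast
qed simp

text \<open>If rows \<open>r\<close> and \<open>r + 1\<close> shared no column, no box in rows up to
  \<open>r\<close> would precede a box of a later row in the componentwise order, so lying in rows
  up to \<open>r\<close> would be constant on the connected shape.\<close>

lemma connected_skew_overlap:
  assumes lam: "is_partition lam" and nu: "is_partition nu"
    and conn: "connected_diagram (skew_diagram lam nu)"
    and x: "(x, s) \<in> skew_diagram lam nu" "x \<le> r" and y: "(y, s') \<in> skew_diagram lam nu" "r < y"
  shows "nu (nat r) < lam (nat (r + 1))"
proof (rule ccontr)
  assume neg: "\<not> ?thesis"
  let ?D = "skew_diagram lam nu"
  have "equivclp (covers (box_poset ?D)) (x, s) (y, s')"
    using conn x y unfolding connected_diagram_def by blast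
  then have "fst (x, s) \<le> r \<longleftrightarrow> fst (y, s') \<le> r"
  proof (rule equivclp_invariant[where P = "\<lambda>e. fst e \<le> r"])
    fix u v assume "covers (box_poset ?D) u v"
    then obtain i j k l where uv: "u = (i, j)" "v = (k, l)" "(i, j) \<in> ?D" "(k, l) \<in> ?D" "i \<le> k" "j \<le> l"
      by (cases u; cases v) (auto simp: covers_def box_poset_def lless_def)
    show "fst u \<le> r \<longleftrightarrow> fst v \<le> r"
    proof (rule ccontr)
      assume "\<not> ?thesis"
      then have *: "i \<le> r" "r < k" using uv by auto
      have "1 \<le> i" "int (nu (nat i)) < j" "l \<le> int (lam (nat k))" using uv by (auto simp: mem_skew_diagram)
      moreover have "nu (nat r) \<le> nu (nat i)" "lam (nat k) \<le> lam (nat (r + 1))"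
        using * \<open>1 \<le> i\<close> by (auto intro!: is_partition_antimono[OF nu] is_partition_antimono[OF lam])
      ultimately show False using neg uv by linarith
    qed
  qed
  then show False using x y by simp
qed

lemma balanced_skew_rows:
  assumes lam: "is_partition lam" and nu: "is_partition nu"
    and bal: "balanced (skew_diagram lam nu)" and hw: "has_height_width (skew_diagram lam nu) a b"
  obtains d N L where "balanced_rows (translate d (skew_diagram lam nu)) a b N L"
    "translate d (skew_diagram lam nu) \<subseteq> rectangle a b" "0 < a" "0 < b"
proof -
  let ?S = "skew_diagram lam nu"
  have conn: "connected_diagram ?S" using bal by (simp add: balanced_def)
  then have ne: "?S \<noteq> {}" by (simp add: connected_diagram_def)
  obtain d where d: "translate d ?S \<subseteq> rectangle a b" using hw by (auto simp: has_height_width_def)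
  let ?D = "translate d ?S"
  have in_rect: "(r, s) \<in> ?D \<Longrightarrow> 1 \<le> r \<and> r \<le> int a \<and> 1 \<le> s \<and> s \<le> int b" for r s
    using d mem_rectangle by blast
  obtain s1 s2 r1 r2 where ext: "(1, s1) \<in> ?D" "(int a, s2) \<in> ?D" "(r1, 1) \<in> ?D" "(r2, int b) \<in> ?D"
    using has_height_width_extremes[OF hw ne d] .
  define N where "N r = int (nu (nat (r - fst d))) + snd d" for r
  define L where "L r = int (lam (nat (r - fst d))) + snd d" for r
  have mem: "(r, s) \<in> ?D \<longleftrightarrow> 1 \<le> r - fst d \<and> N r < s \<and> s \<le> L r" for r s
    by (auto simp: mem_translate mem_skew_diagram N_def L_def)
  \<comment> \<open>This keeps \<open>r - fst d\<close> at least 1 for all rows of the rectangle, so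
    that monotonicity of the partitions applies to them.\<close>
  have first: "1 \<le> 1 - fst d" using ext(1) mem by auto
  have D_eq: "?D = {(r, s). 1 \<le> r \<and> r \<le> int a \<and> N r < s \<and> s \<le> L r}"
  proof -
    have "(r, s) \<in> ?D \<longleftrightarrow> 1 \<le> r \<and> r \<le> int a \<and> N r < s \<and> s \<le> L r" for r s
    proof
      assume *: "(r, s) \<in> ?D"
      show "1 \<le> r \<and> r \<le> int a \<and> N r < s \<and> s \<le> L r"
        using in_rect[OF *] iffD1[OF mem *] by simp
    next
      assume "1 \<le> r \<and> r \<le> int a \<and> N r < s \<and> s \<le> L r"
      then show "(r, s) \<in> ?D" unfolding mem using first by linarith
    qed
    then show ?thesis by auto
  qed
  have N_anti: "N r' \<le> N r" and L_anti: "L r' \<le> L r" if "1 \<le> r" "r \<le> r'" for r r'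
    using that first unfolding N_def L_def
    by (auto intro!: is_partition_antimono[OF nu] is_partition_antimono[OF lam])
  have "balanced_rows ?D a b N L"
  proof
    show "?D = {(r, s). 1 \<le> r \<and> r \<le> int a \<and> N r < s \<and> s \<le> L r}" by (rule D_eq)
    show "N r' \<le> N r" "L r' \<le> L r" if "1 \<le> r" "r \<le> r'" for r r'
      using that by (rule N_anti, rule L_anti)
    show "N r < L (r + 1)" if "1 \<le> r" "r < int a" for r
    proof -
      have "nu (nat (r - fst d)) < lam (nat (r - fst d + 1))"
        using ext(1,2) that unfolding mem_translate fst_conv snd_conv
        by (intro connected_skew_overlap[OF lam nu conn, of "1 - fst d" "s1 - snd d" "r - fst d"
              "int a - fst d" "s2 - snd d"]) auto
      moreover have "r - fst d + 1 = r + 1 - fst d" by simp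
      ultimately show ?thesis by (simp add: N_def L_def)
    qed
    have "L 1 \<le> int b" using in_rect[of 1 "L 1"] ext(1) mem by auto
    moreover have "int b \<le> L 1" using ext(4) mem[of r2 "int b"] L_anti[of 1 r2] in_rect[OF ext(4)] by auto
    ultimately show "L 1 = int b" by simp
    have "1 \<le> N (int a) + 1" using in_rect[of "int a" "N (int a) + 1"] ext(2) mem by auto
    moreover have "N (int a) < 1" using ext(3) mem[of r1 1] N_anti[of r1 "int a"] in_rect[OF ext(3)] by auto
    ultimately show "N (int a) = 0" by simp
    show "on_main_antidiagonal a b p q" if "outward_corner ?D p q" for p q
      using bal hw d that unfolding balanced_def by blast
  qed
  moreover have "0 < a" "0 < b" using in_rect[OF ext(1)] by auto
  ultimately show ?thesis using that d by blast
qed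

section \<open>Initial intervals of weak order\<close>

text \<open>A cover label has exactly one descent, as the proof of
  \<open>cover_label_swap_at\<close> shows, so the choice is forced for labels.\<close>

definition descent_pos :: "nat \<Rightarrow> (nat \<Rightarrow> nat) \<Rightarrow> nat" where
  "descent_pos n p = (SOME k. 1 \<le> k \<and> k < n \<and> p (Suc k) < p k)"

definition descent_low :: "nat \<Rightarrow> (nat \<Rightarrow> nat) \<Rightarrow> nat" where
  "descent_low n p = p (Suc (descent_pos n p))"

definition descent_high :: "nat \<Rightarrow> (nat \<Rightarrow> nat) \<Rightarrow> nat" where
  "descent_high n p = p (descent_pos n p)"

abbreviation swap_at :: "(nat \<Rightarrow> nat) \<Rightarrow> nat \<Rightarrow> nat \<Rightarrow> nat" where
  "swap_at u k \<equiv> u \<circ> Transposition.transpose k (Suc k)"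

lemma swap_at_swap_at: "swap_at (swap_at u k) k = u"
  by (simp add: comp_assoc)

lemma inj_on_swap_at: "inj u \<Longrightarrow> inj_on (swap_at u) S"
proof (rule inj_onI)
  fix k l assume "inj u" "swap_at u k = swap_at u l"
  then have "Transposition.transpose k (Suc k) k = Transposition.transpose l (Suc l) k"
    by (metis comp_apply injD)
  then show "k = l" by (auto simp: Transposition.transpose_def split: if_splits)
qed

section \<open>The interval below \<open>w\<close> as a semidistributive lattice of biclosed
  sets\<close>

locale initial_weak_interval =
  fixes n :: nat and w :: "nat \<Rightarrow> nat"
  assumes w: "w permutes {1..n}"
begin

abbreviation L where "L \<equiv> weak_interval n w"
abbreviation I :: "(nat \<Rightarrow> nat) \<Rightarrow> (nat \<times> nat) set" where "I u \<equiv> Inv n (inv u)"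

lemma I_inject: "u permutes {1..n} \<Longrightarrow> v permutes {1..n} \<Longrightarrow> I u = I v \<Longrightarrow> u = v"
  by (metis Inv_inject permutes_inv permutes_inv_inv)

lemma carrier_iff: "u \<in> carrier L \<longleftrightarrow> u permutes {1..n} \<and> I u \<subseteq> I w"
  using w by (auto simp: weak_interval_def weak_order_def at_least_at_most_def Inv_id)

lemma le_iff: "u \<sqsubseteq>\<^bsub>L\<^esub> v \<longleftrightarrow> I u \<subseteq> I v"
  by (simp add: weak_interval_def weak_order_def)

lemma eq_iff: "u .=\<^bsub>L\<^esub> v \<longleftrightarrow> u = v"
  by (simp add: weak_interval_def weak_order_def)

lemma obtain_element:
  assumes "biclosed n B" "B \<subseteq> I w"
  obtains u where "u \<in> carrier L" "I u = B"
proof -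
  obtain v where v: "v permutes {1..n}" "Inv n v = B" using biclosed_imp_Inv[OF assms(1)] .
  then have "inv v \<in> carrier L" "I (inv v) = B"
    using assms(2) by (simp_all add: carrier_iff permutes_inv permutes_inv_inv)
  then show ?thesis by (rule that)
qed

lemma trans_I: "trans (I u)"
  using biclosed_Inv by (auto simp: biclosed_def)

lemma partial_order_L: "partial_order L"
proof
  have "x = y" if "x \<sqsubseteq>\<^bsub>L\<^esub> y" "y \<sqsubseteq>\<^bsub>L\<^esub> x" "x \<in> carrier L" "y \<in> carrier L" for x y
    using that I_inject by (auto simp: le_iff carrier_iff)
  then show "x .=\<^bsub>L\<^esub> y" if "x \<sqsubseteq>\<^bsub>L\<^esub> y" "y \<sqsubseteq>\<^bsub>L\<^esub> x" "x \<in> carrier L" "y \<in> carrier L" for x y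
    using that by (simp add: eq_iff)
  show "(.=\<^bsub>L\<^esub>) = (=)" by (intro ext) (rule eq_iff)
qed (auto simp: le_iff eq_iff)

lemma lattice_L: "lattice L"
proof -
  interpret partial_order L by (rule partial_order_L)
  show ?thesis
  proof
    fix x y assume xy: "x \<in> carrier L" "y \<in> carrier L"
    have "bijoin (I x) (I y) \<subseteq> I w"
      using xy by (intro bijoin_least trans_I) (auto simp: carrier_iff)
    then obtain s where s: "s \<in> carrier L" "I s = bijoin (I x) (I y)"
      by (rule obtain_element[OF biclosed_bijoin[OF biclosed_Inv biclosed_Inv]])
    have "least L s (Upper L {x, y})"
      unfolding least_def Upper_def le_iff
      using s xy bijoin_upper1 bijoin_upper2 bijoin_least[OF _ _ trans_I] by auto
    then show "\<exists>s. least L s (Upper L {x, y})" by blast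
    have sub: "bimeet n (I x) (I y) \<subseteq> I x" "bimeet n (I x) (I y) \<subseteq> I y"
      by (intro bimeet_lower1 bimeet_lower2 biclosed_subset biclosed_Inv)+
    then have "bimeet n (I x) (I y) \<subseteq> I w" using xy by (auto simp: carrier_iff)
    then obtain m where m: "m \<in> carrier L" "I m = bimeet n (I x) (I y)"
      by (rule obtain_element[OF biclosed_bimeet[OF biclosed_Inv biclosed_Inv]])
    have "greatest L m (Lower L {x, y})"
      unfolding greatest_def Lower_def le_iff
      using m xy sub bimeet_greatest[OF biclosed_Inv] by auto
    then show "\<exists>m. greatest L m (Lower L {x, y})" by blast
  qed
qed

sublocale L: lattice L by (rule lattice_L)

lemma I_join:
  assumes "x \<in> carrier L" "y \<in> carrier L"
  shows "I (x \<squnion>\<^bsub>L\<^esub> y) = bijoin (I x) (I y)"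
proof
  have "bijoin (I x) (I y) \<subseteq> I w"
    using assms by (intro bijoin_least trans_I) (auto simp: carrier_iff)
  then obtain s where s: "s \<in> carrier L" "I s = bijoin (I x) (I y)"
    by (rule obtain_element[OF biclosed_bijoin[OF biclosed_Inv biclosed_Inv]])
  then have "x \<squnion>\<^bsub>L\<^esub> y \<sqsubseteq>\<^bsub>L\<^esub> s"
    using assms by (intro L.join_le) (simp_all add: le_iff bijoin_upper1 bijoin_upper2)
  then show "I (x \<squnion>\<^bsub>L\<^esub> y) \<subseteq> bijoin (I x) (I y)" using s by (simp add: le_iff)
  show "bijoin (I x) (I y) \<subseteq> I (x \<squnion>\<^bsub>L\<^esub> y)"
    using L.join_left[OF assms] L.join_right[OF assms]
    by (intro bijoin_least trans_I) (simp_all add: le_iff)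
qed

lemma I_meet:
  assumes "x \<in> carrier L" "y \<in> carrier L"
  shows "I (x \<sqinter>\<^bsub>L\<^esub> y) = bimeet n (I x) (I y)"
proof
  have sub: "bimeet n (I x) (I y) \<subseteq> I x" "bimeet n (I x) (I y) \<subseteq> I y"
    by (intro bimeet_lower1 bimeet_lower2 biclosed_subset biclosed_Inv)+
  then have "bimeet n (I x) (I y) \<subseteq> I w" using assms by (auto simp: carrier_iff)
  then obtain s where s: "s \<in> carrier L" "I s = bimeet n (I x) (I y)"
    by (rule obtain_element[OF biclosed_bimeet[OF biclosed_Inv biclosed_Inv]])
  then have "s \<sqsubseteq>\<^bsub>L\<^esub> x \<sqinter>\<^bsub>L\<^esub> y"
    using assms sub by (intro L.meet_le) (simp_all add: le_iff)
  then show "bimeet n (I x) (I y) \<subseteq> I (x \<sqinter>\<^bsub>L\<^esub> y)" using s by (simp add: le_iff)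
  show "I (x \<sqinter>\<^bsub>L\<^esub> y) \<subseteq> bimeet n (I x) (I y)"
    using L.meet_left[OF assms] L.meet_right[OF assms]
    by (intro bimeet_greatest biclosed_Inv) (simp_all add: le_iff)
qed

lemma finite_semidistributive_lattice_L: "finite_semidistributive_lattice L"
proof
  show "finite (carrier L)"
    by (rule finite_subset[OF _ finite_permutations[of "{1..n}"]]) (auto simp: carrier_iff)
  show "carrier L \<noteq> {}" using w carrier_iff by blast
  fix x y z assume xyz: "x \<in> carrier L" "y \<in> carrier L" "z \<in> carrier L"
  have perm: "u \<in> carrier L \<Longrightarrow> u permutes {1..n}" for u by (simp add: carrier_iff)
  show "x \<squnion>\<^bsub>L\<^esub> y = x \<squnion>\<^bsub>L\<^esub> (y \<sqinter>\<^bsub>L\<^esub> z)" if eq: "x \<squnion>\<^bsub>L\<^esub> y = x \<squnion>\<^bsub>L\<^esub> z"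
  proof (rule I_inject)
    have "bijoin (I x) (I y) = bijoin (I x) (I z)" using eq xyz I_join by metis
    then show "I (x \<squnion>\<^bsub>L\<^esub> y) = I (x \<squnion>\<^bsub>L\<^esub> (y \<sqinter>\<^bsub>L\<^esub> z))"
      using xyz bijoin_semidistributive[OF biclosed_Inv biclosed_Inv biclosed_Inv] by (simp add: I_join I_meet)
  qed (rule perm, use xyz in simp)+
  show "x \<sqinter>\<^bsub>L\<^esub> y = x \<sqinter>\<^bsub>L\<^esub> (y \<squnion>\<^bsub>L\<^esub> z)" if eq: "x \<sqinter>\<^bsub>L\<^esub> y = x \<sqinter>\<^bsub>L\<^esub> z"
  proof (rule I_inject)
    have "bimeet n (I x) (I y) = bimeet n (I x) (I z)" using eq xyz I_meet by metis
    then show "I (x \<sqinter>\<^bsub>L\<^esub> y) = I (x \<sqinter>\<^bsub>L\<^esub> (y \<squnion>\<^bsub>L\<^esub> z))"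
      using xyz bimeet_semidistributive[OF biclosed_Inv biclosed_Inv biclosed_Inv] by (simp add: I_join I_meet)
  qed (rule perm, use xyz in simp)+
qed

sublocale L: finite_semidistributive_lattice L by (rule finite_semidistributive_lattice_L)

section \<open>Covers in the interval and their labels\<close>

lemma covers_swap_at:
  assumes u: "u \<in> carrier L" and k: "1 \<le> k" "k < n" "u k < u (Suc k)" "(u k, u (Suc k)) \<in> I w"
  shows "covers L u (swap_at u k)"
proof -
  have up: "u permutes {1..n}" and Iu: "I u \<subseteq> I w" using u by (auto simp: carrier_iff)
  note adj = Inv_adjacent[OF up k(1-3)]
  have v: "swap_at u k \<in> carrier L"
    unfolding carrier_iff adj(2) using adj(1) Iu k(4) by simp
  have "u \<noteq> swap_at u k" using adj(2,3) by (metis insertI1)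
  moreover have "z = u \<or> z = swap_at u k"
    if "z \<in> carrier L" "I u \<subseteq> I z" "I z \<subseteq> insert (u k, u (Suc k)) (I u)" for z
  proof -
    have "I z = I u \<or> I z = insert (u k, u (Suc k)) (I u)" using that by blast
    then show ?thesis using that(1) I_inject up adj by (metis carrier_iff)
  qed
  ultimately show ?thesis
    unfolding covers_def lless_def eq_iff le_iff using u v adj(2) by (auto simp del: o_apply)
qed

text \<open>Some descent of \<open>v\<close> has its pair outside \<open>I u\<close>, since
  otherwise the descents would generate \<open>I v\<close> inside \<open>I u\<close>. Undoing that
  descent stays above \<open>u\<close> and drops strictly below \<open>v\<close>, hence gives
  \<open>u\<close>.\<close>

lemma covers_imp_swap_at:
  assumes c: "covers L u v"
  obtains k where "1 \<le> k" "k < n" "u k < u (Suc k)" "(u k, u (Suc k)) \<in> I w" "v = swap_at u k"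
proof -
  have uv: "u \<in> carrier L" "v \<in> carrier L" "I u \<subseteq> I v" "u \<noteq> v"
    using L.covers_less[OF c] by (auto simp: le_iff)
  then have up: "u permutes {1..n}" and vp: "v permutes {1..n}" and Iv: "I v \<subseteq> I w"
    by (auto simp: carrier_iff)
  have "\<not> I v \<subseteq> I u" using uv I_inject[OF up vp] by blast
  then obtain k where k: "1 \<le> k" "k < n" "v (Suc k) < v k" "(v (Suc k), v k) \<notin> I u"
    using Inv_subset_if_descents[OF vp biclosed_Inv uv(3)] by blast
  note adj = Inv_adjacent_descent[OF vp k(1-3)]
  have "I u \<subseteq> I (swap_at v k)" using uv(3) subset_insert[OF k(4)] unfolding adj(2) by metis
  moreover have "I (swap_at v k) \<subseteq> I v" using adj(2) by blast
  moreover have "swap_at v k \<noteq> v" using adj(2,3) by (metis insertI1)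
  ultimately have "swap_at v k = u"
    using L.covers_between[OF c, of "swap_at v k"] adj(1) Iv by (auto simp: carrier_iff le_iff)
  then have u: "u = swap_at v k" ..
  have "(v (Suc k), v k) \<in> I w" using adj(2) Iv by blast
  then have "1 \<le> k \<and> k < n \<and> u k < u (Suc k) \<and> (u k, u (Suc k)) \<in> I w \<and> v = swap_at u k"
    using k unfolding u swap_at_swap_at by simp
  then show ?thesis using that by blast
qed

lemma upper_covers_eq:
  assumes "u \<in> carrier L"
  shows "{v. covers L u v} = swap_at u ` {k \<in> {1..<n}. u k < u (Suc k) \<and> (u k, u (Suc k)) \<in> I w}"
  using covers_swap_at[OF assms] by (auto elim!: covers_imp_swap_at)

lemma lower_covers_eq:
  assumes u: "u \<in> carrier L"
  shows "{v. covers L v u} = swap_at u ` {k \<in> {1..<n}. u (Suc k) < u k}"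
proof (intro equalityI subsetI)
  fix v assume "v \<in> {v. covers L v u}"
  then obtain k where k: "1 \<le> k" "k < n" "v k < v (Suc k)" "u = swap_at v k"
    by (auto elim: covers_imp_swap_at)
  then have "v = swap_at u k" "k \<in> {k \<in> {1..<n}. u (Suc k) < u k}"
    by (simp_all add: comp_assoc)
  then show "v \<in> swap_at u ` {k \<in> {1..<n}. u (Suc k) < u k}" by blast
next
  fix v assume "v \<in> swap_at u ` {k \<in> {1..<n}. u (Suc k) < u k}"
  then obtain k where k: "1 \<le> k" "k < n" "u (Suc k) < u k" "v = swap_at u k" by auto
  have up: "u permutes {1..n}" and Iu: "I u \<subseteq> I w" using u by (auto simp: carrier_iff)
  note adj = Inv_adjacent_descent[OF up k(1-3), folded k(4)]
  have "v \<in> carrier L" "(v k, v (Suc k)) \<in> I w"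
    using adj Iu k(4) by (auto simp: carrier_iff)
  then have "covers L v (swap_at v k)"
    using k by (intro covers_swap_at) auto
  then show "v \<in> {v. covers L v u}" using k(4) by (simp add: comp_assoc)
qed

text \<open>Undoing any descent of the label gives an element strictly below it, hence below
  \<open>u\<close>; so the descent pair is \<open>(u k, u (Suc k))\<close>, which \<open>I u\<close>
  lacks. A value \<open>z\<close> between the two that stands to the left is not inverted with
  \<open>u (Suc k)\<close>, so cotransitivity puts \<open>(u k, z)\<close> into
  \<open>I p\<close>.\<close>

lemma cover_label_swap_at:
  assumes u: "u \<in> carrier L" and k: "1 \<le> k" "k < n" "u k < u (Suc k)" "(u k, u (Suc k)) \<in> I w"
  defines "p \<equiv> cover_label L u (swap_at u k)"
  shows "descent_low n p = u k" and "descent_high n p = u (Suc k)"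
    and "\<And>z. u k < z \<Longrightarrow> z < u (Suc k) \<Longrightarrow> (u k, z) \<in> I p \<longleftrightarrow> inv u z < k"
proof -
  let ?x = "u k" and ?y = "u (Suc k)"
  have c: "covers L u (swap_at u k)" by (rule covers_swap_at[OF u k])
  have up: "u permutes {1..n}" using u by (simp add: carrier_iff)
  have p: "p \<in> carrier L" unfolding p_def by (rule L.cover_label_closed[OF c])
  then have pp: "p permutes {1..n}" and Ipw: "I p \<subseteq> I w" by (auto simp: carrier_iff)
  have Ip: "I p \<subseteq> insert (?x, ?y) (I u)"
    using L.cover_label_le_top[OF c] Inv_adjacent(2)[OF up k(1-3)] by (simp add: le_iff p_def)
  have xy: "(?x, ?y) \<in> I p"
    using L.cover_label_not_le[OF c] Ip by (auto simp: le_iff p_def)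
  have desc: "p (Suc l) = ?x \<and> p l = ?y" if l: "1 \<le> l" "l < n" "p (Suc l) < p l" for l
  proof -
    note adj = Inv_adjacent_descent[OF pp l]
    have "swap_at p l \<in> carrier L" using adj(1,2) Ipw by (auto simp: carrier_iff)
    moreover have "swap_at p l \<sqsubseteq>\<^bsub>L\<^esub> p" using adj(2) by (auto simp: le_iff)
    moreover have "swap_at p l \<noteq> p" using adj(2,3) by (metis insertI1)
    ultimately have "I (swap_at p l) \<subseteq> I u"
      using L.cover_label_strict_lower[OF c] by (simp add: p_def le_iff)
    moreover have "(?x, ?y) \<notin> I u" by (rule Inv_adjacent(3)[OF up k(1-3)])
    ultimately show ?thesis using xy adj(2) by auto
  qed
  have "\<exists>l. 1 \<le> l \<and> l < n \<and> p (Suc l) < p l"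
  proof (rule ccontr)
    assume "\<not> ?thesis"
    then have "I p \<subseteq> {}"
      by (intro Inv_subset_if_descents[OF pp]) (auto simp: biclosed_def)
    then show False using xy by blast
  qed
  then have "1 \<le> descent_pos n p \<and> descent_pos n p < n \<and> p (Suc (descent_pos n p)) < p (descent_pos n p)"
    unfolding descent_pos_def by (rule someI_ex)
  then show "descent_low n p = ?x" "descent_high n p = ?y"
    using desc by (auto simp: descent_low_def descent_high_def)
  fix z assume z: "?x < z" "z < ?y"
  have pos: "inv u ?x = k" "inv u ?y = Suc k" by (simp_all add: permutes_inverses[OF up])
  show "(?x, z) \<in> I p \<longleftrightarrow> inv u z < k"
  proof
    assume "(?x, z) \<in> I p"
    then have "(?x, z) \<in> I u" using Ip z by blast
    then show "inv u z < k" by (simp add: Inv_iff pos)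
  next
    assume "inv u z < k"
    then have "(z, ?y) \<notin> I u" by (simp add: Inv_iff pos)
    then have "(z, ?y) \<notin> I p" using Ip z by blast
    then show "(?x, z) \<in> I p" using biclosed_cotrans[OF biclosed_Inv xy z] by blast
  qed
qed

end

section \<open>Rooks\<close>

text \<open>\<open>left_x\<close> and \<open>left_y\<close> recover from the label \<open>p\<close> of a cover whether \<open>x0\<close>, respectively \<open>y0\<close>,
  stands to the left of the swapped pair. Only values between the two swapped ones are recorded in
  \<open>p\<close>; in the remaining cases \<open>x0\<close> (\<open>y0\<close>) and the smaller (larger) swapped value are not inverted
  in \<open>w\<close>, so that their order is the same in the whole interval.\<close>

definition left_x :: "nat \<Rightarrow> nat \<Rightarrow> (nat \<Rightarrow> nat) \<Rightarrow> bool" where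
  "left_x n x0 p \<longleftrightarrow> (descent_low n p < x0 \<longrightarrow> (descent_low n p, x0) \<in> Inv n (inv p))"

definition left_y :: "nat \<Rightarrow> nat \<Rightarrow> (nat \<Rightarrow> nat) \<Rightarrow> bool" where
  "left_y n y0 p \<longleftrightarrow> y0 < descent_high n p \<and> (descent_low n p, y0) \<in> Inv n (inv p)"

definition rook_active :: "nat \<Rightarrow> (nat \<Rightarrow> nat) \<Rightarrow> nat \<times> nat \<Rightarrow> (nat \<Rightarrow> nat) \<Rightarrow> bool" where
  "rook_active n w e p \<longleftrightarrow>
     (descent_low n p, snd e) \<in> Inv n (inv w) \<and> (fst e, descent_high n p) \<in> Inv n (inv w)"

text \<open>Expressed through the label alone, this is \<open>side\<close> times the change of
  \<open>in_col\<close> at the swapped positions (\<open>rook_up_step\<close>); at an active ascent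
  the change is 1.\<close>

definition rook_up :: "nat \<Rightarrow> (nat \<Rightarrow> nat) \<Rightarrow> nat \<times> nat \<Rightarrow> (nat \<Rightarrow> nat) \<Rightarrow> real" where
  "rook_up n w e p = (if rook_active n w e p
     then of_bool (left_x n (fst e) p) - of_bool (left_y n (snd e) p) else 0)"

text \<open>At an active descent the change of \<open>in_col\<close> is -1, which flips the sign.
  The larger swapped value now occupies the left position, whence the special treatment of
  \<open>snd e\<close> and \<open>fst e\<close>.\<close>

definition rook_down :: "nat \<Rightarrow> (nat \<Rightarrow> nat) \<Rightarrow> nat \<times> nat \<Rightarrow> (nat \<Rightarrow> nat) \<Rightarrow> real" where
  "rook_down n w e p = (if rook_active n w e p
     then of_bool (left_y n (snd e) p \<or> descent_high n p = snd e)
       - of_bool (left_x n (fst e) p \<and> descent_low n p \<noteq> fst e) else 0)"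

text \<open>The two coefficients cancel unless the label has smaller value \<open>x0\<close> or
  larger value \<open>y0\<close>; each such coincidence leaves 1, and then the label is active
  because both pairs are inversions of \<open>w\<close>.\<close>

lemma rook_up_down:
  assumes "(x0, y0) \<in> Inv n (inv w)" "(descent_low n p, descent_high n p) \<in> Inv n (inv w)"
  shows "rook_up n w (x0, y0) p + rook_down n w (x0, y0) p
    = of_bool (descent_low n p = x0) + of_bool (descent_high n p = y0)"
  using assms unfolding rook_up_def rook_down_def rook_active_def left_x_def left_y_def by auto

context initial_weak_interval
begin

lemma sum_upper_covers:
  assumes u: "u \<in> carrier L"
  shows "(\<Sum>v | covers L u v. h v) =
    (\<Sum>k\<in>{1..<n}. if u k < u (Suc k) \<and> (u k, u (Suc k)) \<in> I w then h (swap_at u k) else (0::real))"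
proof -
  have "inj u" using u permutes_inj by (auto simp: carrier_iff)
  then show ?thesis
    unfolding upper_covers_eq[OF u] sum.inter_filter[OF finite_atLeastLessThan, symmetric]
    by (intro sum.reindex_cong[OF inj_on_swap_at]) auto
qed

lemma sum_lower_covers:
  assumes u: "u \<in> carrier L"
  shows "(\<Sum>v | covers L v u. h v) =
    (\<Sum>k\<in>{1..<n}. if u (Suc k) < u k then h (swap_at u k) else (0::real))"
proof -
  have "inj u" using u permutes_inj by (auto simp: carrier_iff)
  then show ?thesis
    unfolding lower_covers_eq[OF u] sum.inter_filter[OF finite_atLeastLessThan, symmetric]
    by (intro sum.reindex_cong[OF inj_on_swap_at]) auto
qed

end

section \<open>Evaluation of a single rook along the word of \<open>u\<close>\<close>

locale rook = initial_weak_interval +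
  fixes x0 y0 :: nat
  assumes box: "(x0, y0) \<in> Inv n (inv w)"
    and rectangle_closed: "(x, y0) \<in> Inv n (inv w) \<Longrightarrow> (x0, y) \<in> Inv n (inv w) \<Longrightarrow> (x, y) \<in> Inv n (inv w)"
begin

text \<open>A value in both roles would make \<open>(z, z)\<close> an inversion.\<close>

lemma disjoint: "(z, y0) \<in> I w \<Longrightarrow> (x0, z) \<notin> I w"
  using rectangle_closed[of z z] by (auto simp: Inv_iff)

text \<open>A letter smaller than \<open>x0\<close> is inverted in \<open>u\<close> with the one of
  \<open>x0\<close>, \<open>y0\<close> to its left, and a letter larger than \<open>y0\<close> with
  the one to its right; transitivity with the box then applies. For a value in between,
  cotransitivity of \<open>I w\<close> splits the box.\<close>

lemma between_cases:
  assumes u: "u \<in> carrier L" and m: "1 \<le> m" "m \<le> n"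
    and seg: "(inv u x0 \<le> m \<and> m \<le> inv u y0) \<or> (inv u y0 \<le> m \<and> m \<le> inv u x0)"
  shows "(x0, u m) \<in> I w \<or> (u m, y0) \<in> I w"
proof -
  have up: "u permutes {1..n}" and Iu: "I u \<subseteq> I w" using u by (auto simp: carrier_iff)
  define z where "z = u m"
  have pos: "inv u z = m" by (simp add: z_def permutes_inverses[OF up])
  have "z \<in> {1..n}" unfolding z_def permutes_in_image[OF up] using m by simp
  then have z: "1 \<le> z" "z \<le> n" by auto
  have b: "1 \<le> x0" "x0 < y0" "y0 \<le> n" using box by (auto simp: Inv_iff)
  have "(x0, z) \<in> I w \<or> (z, y0) \<in> I w"
  proof (cases "z = x0 \<or> z = y0")
    case True
    then show ?thesis using box by auto
  next
    case False
    then have ne: "m \<noteq> inv u x0" "m \<noteq> inv u y0" using z_def permutes_inverses(1)[OF up] by auto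
    consider "z < x0" | "x0 < z \<and> z < y0" | "y0 < z" using False by linarith
    then show ?thesis
    proof cases
      case 1
      then have "(z, x0) \<in> I u \<or> (z, y0) \<in> I u"
        using seg ne z b pos by (auto simp: Inv_iff)
      then show ?thesis using Iu biclosed_trans[OF biclosed_Inv _ box] by blast
    next
      case 2
      then show ?thesis using biclosed_cotrans[OF biclosed_Inv box] by blast
    next
      case 3
      then have "(x0, z) \<in> I u \<or> (y0, z) \<in> I u"
        using seg ne z b pos by (auto simp: Inv_iff)
      then show ?thesis using Iu biclosed_trans[OF biclosed_Inv box] by blast
    qed
  qed
  then show ?thesis by (simp add: z_def)
qed

text \<open>At steps between the positions of \<open>x0\<close> and \<open>y0\<close> this is 1 if
  \<open>x0\<close> comes first and -1 if \<open>y0\<close> does; at all other steps it is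
  0.\<close>

definition side :: "(nat \<Rightarrow> nat) \<Rightarrow> nat \<Rightarrow> real" where
  "side u k = of_bool (inv u x0 \<le> k) - of_bool (inv u y0 \<le> k)"

definition in_col :: "(nat \<Rightarrow> nat) \<Rightarrow> nat \<Rightarrow> real" where
  "in_col u k = of_bool ((x0, u k) \<in> I w)"

text \<open>Between \<open>x0\<close> and \<open>y0\<close> every letter is of row or column kind;
  when both changes of kind are excluded, \<open>in_col\<close> is constant across the step.\<close>

lemma side_step_zero:
  assumes u: "u \<in> carrier L" and k: "1 \<le> k" "k < n"
    and up: "(u k, y0) \<in> I w \<Longrightarrow> (x0, u (Suc k)) \<in> I w \<Longrightarrow> False"
    and down: "(u (Suc k), y0) \<in> I w \<Longrightarrow> (x0, u k) \<in> I w \<Longrightarrow> False"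
  shows "side u k * (in_col u (Suc k) - in_col u k) = 0"
proof (cases "side u k = 0")
  case False
  then have "(inv u x0 \<le> k \<and> Suc k \<le> inv u y0) \<or> (inv u y0 \<le> k \<and> Suc k \<le> inv u x0)"
    by (auto simp: side_def)
  then have "(x0, u k) \<in> I w \<or> (u k, y0) \<in> I w" "(x0, u (Suc k)) \<in> I w \<or> (u (Suc k), y0) \<in> I w"
    using between_cases[OF u, of k] between_cases[OF u, of "Suc k"] k by auto
  then show ?thesis using up down by (auto simp: in_col_def)
qed simp

text \<open>Below, \<open>P\<close> stands for the inversion set of the label of the cover that swaps \<open>x\<close> and \<open>y\<close>.\<close>

lemma left_x_position:
  assumes u: "u \<in> carrier L" and x: "(x, y0) \<in> I w" "x \<noteq> x0" and y: "(x0, y) \<in> I w"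
    and pos: "k \<le> inv u x" "inv u x \<le> Suc k" "inv u x0 \<noteq> k" "inv u x0 \<noteq> Suc k"
    and P: "x < x0 \<Longrightarrow> x0 < y \<Longrightarrow> (x, x0) \<in> P \<longleftrightarrow> inv u x0 < k"
  shows "(x < x0 \<longrightarrow> (x, x0) \<in> P) \<longleftrightarrow> inv u x0 \<le> k"
proof (cases "x < x0")
  case True
  have "x0 < y" using y by (simp add: Inv_iff)
  then show ?thesis using P True pos by auto
next
  case False
  \<comment> \<open>By \<open>disjoint\<close> the pair is no inversion of \<open>w\<close>, so
    \<open>x0\<close> stays to the left of the larger value \<open>x\<close>.\<close>
  have "(x0, x) \<notin> I u" using disjoint[OF x(1)] u by (auto simp: carrier_iff)
  then have "inv u x0 \<le> inv u x" using False x y by (auto simp: Inv_iff not_less)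
  then show ?thesis using False pos by auto
qed

lemma left_y_position:
  assumes u: "u \<in> carrier L" and x: "(x, y0) \<in> I w" and y: "(x0, y) \<in> I w" "y \<noteq> y0"
    and pos: "k \<le> inv u y" "inv u y \<le> Suc k" "inv u y0 \<noteq> k" "inv u y0 \<noteq> Suc k"
    and P: "x < y0 \<Longrightarrow> y0 < y \<Longrightarrow> (x, y0) \<in> P \<longleftrightarrow> inv u y0 < k"
  shows "(y0 < y \<and> (x, y0) \<in> P) \<longleftrightarrow> inv u y0 \<le> k"
proof (cases "y0 < y")
  case True
  have "x < y0" using x by (simp add: Inv_iff)
  then show ?thesis using P True pos by auto
next
  case False
  have "(y, y0) \<notin> I w" using disjoint[of y] y by blast
  then have "(y, y0) \<notin> I u" using u by (auto simp: carrier_iff)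
  then have "inv u y \<le> inv u y0" using False x y by (auto simp: Inv_iff not_less)
  then show ?thesis using False pos by auto
qed

text \<open>An active label marks a step from row kind to column kind. The opposite change cannot
  occur at an ascent: \<open>rectangle_closed\<close> would give \<open>u (Suc k) < u k\<close>.
  Hence inactive labels contribute 0.\<close>

lemma rook_up_step:
  assumes u: "u \<in> carrier L" and k: "1 \<le> k" "k < n" "u k < u (Suc k)" "(u k, u (Suc k)) \<in> I w"
  shows "rook_up n w (x0, y0) (cover_label L u (swap_at u k)) = side u k * (in_col u (Suc k) - in_col u k)"
proof -
  define p where "p = cover_label L u (swap_at u k)"
  define x y where "x = u k" and "y = u (Suc k)"
  have lab: "descent_low n p = x" "descent_high n p = y"
    and btw: "x < z \<Longrightarrow> z < y \<Longrightarrow> (x, z) \<in> I p \<longleftrightarrow> inv u z < k" for z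
    using cover_label_swap_at[OF u k] by (auto simp: p_def x_def y_def)
  have up: "u permutes {1..n}" using u by (simp add: carrier_iff)
  have pos: "inv u z = k \<longleftrightarrow> z = x" "inv u z = Suc k \<longleftrightarrow> z = y" for z
    unfolding x_def y_def permutes_inv_eq[OF up] by auto
  have xy: "x < y" using k by (simp add: x_def y_def)
  have "rook_up n w (x0, y0) p = side u k * (in_col u (Suc k) - in_col u k)"
  proof (cases "(x, y0) \<in> I w \<and> (x0, y) \<in> I w")
    case True
    have px: "inv u x = k" and py: "inv u y = Suc k" using pos by auto
    have X: "left_x n x0 p \<longleftrightarrow> inv u x0 \<le> k"
    proof (cases "x = x0")
      case True
      then show ?thesis using px by (simp add: left_x_def lab)
    next
      case False
      moreover have "inv u x0 \<noteq> k" "inv u x0 \<noteq> Suc k"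
        unfolding pos using False \<open>(x, y0) \<in> I w \<and> (x0, y) \<in> I w\<close> by (auto simp: Inv_iff)
      ultimately show ?thesis
        unfolding left_x_def lab using True px btw
        by (intro left_x_position[OF u, where y = y]) auto
    qed
    have Y: "left_y n y0 p \<longleftrightarrow> inv u y0 \<le> k"
    proof (cases "y = y0")
      case True
      then show ?thesis using py by (simp add: left_y_def lab)
    next
      case False
      moreover have "inv u y0 \<noteq> k" "inv u y0 \<noteq> Suc k"
        unfolding pos using False \<open>(x, y0) \<in> I w \<and> (x0, y) \<in> I w\<close> by (auto simp: Inv_iff)
      ultimately show ?thesis
        unfolding left_y_def lab using True py btw
        by (intro left_y_position[OF u, where x = x]) auto
    qed
    have "in_col u (Suc k) = 1" "in_col u k = 0"
      using True disjoint by (auto simp: in_col_def x_def y_def)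
    then show ?thesis using True X Y by (simp add: rook_up_def rook_active_def lab side_def)
  next
    case False
    have "side u k * (in_col u (Suc k) - in_col u k) = 0"
    proof (rule side_step_zero[OF u k(1,2)])
      show False if "(u (Suc k), y0) \<in> I w" "(x0, u k) \<in> I w"
        using rectangle_closed[OF that] k(3) by (simp add: Inv_iff)
    qed (use False in \<open>auto simp: x_def y_def\<close>)
    moreover have "\<not> rook_active n w (x0, y0) p" using False by (simp add: rook_active_def lab)
    ultimately show ?thesis by (simp add: rook_up_def)
  qed
  then show ?thesis by (simp add: p_def)
qed

lemma rook_down_step:
  assumes u: "u \<in> carrier L" and k: "1 \<le> k" "k < n" "u (Suc k) < u k"
  shows "rook_down n w (x0, y0) (cover_label L (swap_at u k) u) = side u k * (in_col u (Suc k) - in_col u k)"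
proof -
  define v where "v = swap_at u k"
  define p where "p = cover_label L v u"
  define x y where "x = u (Suc k)" and "y = u k"
  have up: "u permutes {1..n}" and Iu: "I u \<subseteq> I w" using u by (auto simp: carrier_iff)
  note adj = Inv_adjacent_descent[OF up k, folded v_def]
  have vu: "u = swap_at v k" "v k = x" "v (Suc k) = y" by (simp_all add: v_def x_def y_def comp_assoc)
  have v: "v \<in> carrier L" "x < y" "(x, y) \<in> I w"
    using adj Iu k by (auto simp: carrier_iff x_def y_def)
  have pos: "inv u z = k \<longleftrightarrow> z = y" "inv u z = Suc k \<longleftrightarrow> z = x" for z
    unfolding x_def y_def permutes_inv_eq[OF up] by auto
  \<comment> \<open>The label is described through the lower element \<open>v\<close>; letters other
    than \<open>x\<close> and \<open>y\<close> have the same position in \<open>v\<close> and in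
    \<open>u\<close>.\<close>
  have iv: "inv v z = inv u z" if "z \<noteq> x" "z \<noteq> y" for z
  proof -
    have "inv v = Transposition.transpose k (Suc k) \<circ> inv u"
      unfolding v_def using permutes_bij[OF up] by (simp add: o_inv_distrib)
    then show ?thesis using pos that by simp
  qed
  have lab: "descent_low n p = x" "descent_high n p = y"
    and btw: "x < z \<Longrightarrow> z < y \<Longrightarrow> (x, z) \<in> I p \<longleftrightarrow> inv u z < k" for z
    using cover_label_swap_at[OF v(1) k(1,2), folded vu(1), unfolded vu(2,3), OF v(2,3), folded p_def] iv
    by auto
  have "rook_down n w (x0, y0) p = side u k * (in_col u (Suc k) - in_col u k)"
  proof (cases "(x, y0) \<in> I w \<and> (x0, y) \<in> I w")
    case True
    have px: "inv u x = Suc k" and py: "inv u y = k" using pos by auto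
    have X: "left_x n x0 p \<and> x \<noteq> x0 \<longleftrightarrow> inv u x0 \<le> k"
    proof (cases "x = x0")
      case True
      then show ?thesis using px by simp
    next
      case False
      moreover have "inv u x0 \<noteq> k" "inv u x0 \<noteq> Suc k"
        unfolding pos using False \<open>(x, y0) \<in> I w \<and> (x0, y) \<in> I w\<close> by (auto simp: Inv_iff)
      ultimately have "left_x n x0 p \<longleftrightarrow> inv u x0 \<le> k"
        unfolding left_x_def lab using True px btw
        by (intro left_x_position[OF u, where y = y]) auto
      then show ?thesis using False by simp
    qed
    have Y: "left_y n y0 p \<or> y = y0 \<longleftrightarrow> inv u y0 \<le> k"
    proof (cases "y = y0")
      case True
      then show ?thesis using py by simp
    next
      case False
      moreover have "inv u y0 \<noteq> k" "inv u y0 \<noteq> Suc k"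
        unfolding pos using False \<open>(x, y0) \<in> I w \<and> (x0, y) \<in> I w\<close> by (auto simp: Inv_iff)
      ultimately have "left_y n y0 p \<longleftrightarrow> inv u y0 \<le> k"
        unfolding left_y_def lab using True py btw
        by (intro left_y_position[OF u, where x = x]) auto
      then show ?thesis using False by simp
    qed
    have "in_col u (Suc k) = 0" "in_col u k = 1"
      using True disjoint by (auto simp: in_col_def x_def y_def)
    then show ?thesis using True X Y by (simp add: rook_down_def rook_active_def lab side_def)
  next
    case False
    have "side u k * (in_col u (Suc k) - in_col u k) = 0"
    proof (rule side_step_zero[OF u k(1,2)])
      show False if "(u k, y0) \<in> I w" "(x0, u (Suc k)) \<in> I w"
        using rectangle_closed[OF that] k(3) by (simp add: Inv_iff)
    qed (use False in \<open>auto simp: x_def y_def\<close>)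
    moreover have "\<not> rook_active n w (x0, y0) p" using False by (simp add: rook_active_def lab)
    ultimately show ?thesis by (simp add: rook_down_def)
  qed
  then show ?thesis by (simp add: p_def v_def)
qed

text \<open>The sum telescopes between the positions of \<open>x0\<close> and \<open>y0\<close>,
  where \<open>in_col\<close> is 0 and 1 respectively; the sign of \<open>side\<close> compensates
  when \<open>y0\<close> stands first.\<close>

lemma sum_side_step:
  assumes u: "u \<in> carrier L"
  shows "(\<Sum>k\<in>{1..<n}. side u k * (in_col u (Suc k) - in_col u k)) = 1"
proof -
  have up: "u permutes {1..n}" using u by (simp add: carrier_iff)
  define i j where "i = inv u x0" and "j = inv u y0"
  have b: "1 \<le> x0" "x0 < y0" "y0 \<le> n" using box by (auto simp: Inv_iff)
  have "i \<in> {1..n}" "j \<in> {1..n}"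
    unfolding i_def j_def permutes_in_image[OF permutes_inv[OF up]] using b by auto
  then have ij: "1 \<le> i" "i \<le> n" "1 \<le> j" "j \<le> n" by auto
  have uij: "u i = x0" "u j = y0" by (simp_all add: i_def j_def permutes_inverses[OF up])
  then have col: "in_col u i = 0" "in_col u j = 1" and "i \<noteq> j"
    using box b by (auto simp: in_col_def Inv_iff)
  let ?d = "\<lambda>k. in_col u (Suc k) - in_col u k"
  show ?thesis
  proof (cases "i < j")
    case True
    have "(\<Sum>k\<in>{1..<n}. side u k * ?d k) = (\<Sum>k\<in>{i..<j}. ?d k)"
      using True ij by (intro sum.mono_neutral_cong_right) (auto simp: side_def i_def j_def)
    also have "\<dots> = in_col u j - in_col u i" using True by (intro sum_Suc_diff') simp
    finally show ?thesis using col by simp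
  next
    case False
    then have ji: "j < i" using \<open>i \<noteq> j\<close> by simp
    have "(\<Sum>k\<in>{1..<n}. side u k * ?d k) = (\<Sum>k\<in>{j..<i}. - ?d k)"
      using ji ij by (intro sum.mono_neutral_cong_right) (auto simp: side_def i_def j_def)
    also have "\<dots> = - (in_col u i - in_col u j)"
      unfolding sum_negf using ji by (subst sum_Suc_diff') simp_all
    finally show ?thesis using col by simp
  qed
qed

lemma rook_sum_eq_1:
  assumes u: "u \<in> carrier L"
  shows "(\<Sum>v | covers L u v. rook_up n w (x0, y0) (cover_label L u v))
    + (\<Sum>v | covers L v u. rook_down n w (x0, y0) (cover_label L v u)) = 1"
proof -
  have inj: "inj u" using u permutes_inj by (auto simp: carrier_iff)
  let ?s = "\<lambda>k. side u k * (in_col u (Suc k) - in_col u k)"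
  let ?U = "\<lambda>k. if u k < u (Suc k) \<and> (u k, u (Suc k)) \<in> I w
    then rook_up n w (x0, y0) (cover_label L u (swap_at u k)) else 0"
  let ?D = "\<lambda>k. if u (Suc k) < u k then rook_down n w (x0, y0) (cover_label L (swap_at u k) u) else 0"
  have "?U k + ?D k = ?s k" if "k \<in> {1..<n}" for k
  proof -
    have k: "1 \<le> k" "k < n" using that by auto
    have "u k \<noteq> u (Suc k)" using inj by (simp add: inj_eq)
    then consider "u k < u (Suc k)" "(u k, u (Suc k)) \<in> I w" | "u k < u (Suc k)" "(u k, u (Suc k)) \<notin> I w"
      | "u (Suc k) < u k" by linarith
    then show ?thesis
    proof cases
      case 1
      then show ?thesis using rook_up_step[OF u k] by simp
    next
      case 2
      \<comment> \<open>This ascent leads out of the interval. By \<open>rectangle_closed\<close>, a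
        change of kind here would either make its pair an inversion of \<open>w\<close> or
        contradict \<open>u k < u (Suc k)\<close>.\<close>
      have "?s k = 0"
      proof (rule side_step_zero[OF u k])
        show False if "(u k, y0) \<in> I w" "(x0, u (Suc k)) \<in> I w"
          using rectangle_closed[OF that] 2 by simp
        show False if "(u (Suc k), y0) \<in> I w" "(x0, u k) \<in> I w"
          using rectangle_closed[OF that] 2 by (simp add: Inv_iff)
      qed
      then show ?thesis using 2 by simp
    next
      case 3
      then show ?thesis using rook_down_step[OF u k] by simp
    qed
  qed
  then have "(\<Sum>k\<in>{1..<n}. ?U k) + (\<Sum>k\<in>{1..<n}. ?D k) = (\<Sum>k\<in>{1..<n}. ?s k)"
    unfolding sum.distrib[symmetric] by (intro sum.cong) auto
  then show ?thesis
    unfolding sum_upper_covers[OF u] sum_lower_covers[OF u] sum_side_step[OF u] .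
qed

end

section \<open>The Rothe diagram and the rooks on the antidiagonal boxes\<close>

lemma Inv_inv_iff:
  assumes w: "w permutes {1..n}"
  shows "(x, y) \<in> Inv n (inv w) \<longleftrightarrow> x < y \<and> (inv w y, inv w x) \<in> Inv n w"
proof -
  have "1 \<le> inv w z \<and> inv w z \<le> n \<longleftrightarrow> 1 \<le> z \<and> z \<le> n" for z
    using permutes_in_image[OF permutes_inv[OF w], of z] by simp
  then show ?thesis
    unfolding Inv_iff permutes_inverses[OF w] by (metis le_trans less_imp_le)
qed

text \<open>In terms of pairs of values, \<open>x\<close> indexes the column and \<open>y\<close>,
  through \<open>inv w\<close>, the row; these are the coordinates in which rooks are
  stated.\<close>

lemma rothe_diagram_eq:
  assumes w: "w permutes {1..n}"
  shows "rothe_diagram n w = (\<lambda>(x, y). (int (inv w y), int x)) ` Inv n (inv w)"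
proof (intro equalityI subsetI)
  fix e assume "e \<in> rothe_diagram n w"
  then obtain i j where e: "e = (int i, int (w j))" "(i, j) \<in> Inv n w"
    by (auto simp: rothe_diagram_def)
  then have "(w j, w i) \<in> Inv n (inv w)"
    unfolding Inv_inv_iff[OF w] permutes_inverses[OF w] by (simp add: Inv_iff)
  then show "e \<in> (\<lambda>(x, y). (int (inv w y), int x)) ` Inv n (inv w)"
    using e by (force simp: permutes_inverses[OF w])
next
  fix e assume "e \<in> (\<lambda>(x, y). (int (inv w y), int x)) ` Inv n (inv w)"
  then obtain x y where e: "e = (int (inv w y), int x)" "(x, y) \<in> Inv n (inv w)" by auto
  then have "(inv w y, inv w x) \<in> Inv n w" using Inv_inv_iff[OF w] by blast
  moreover have "e = (int (inv w y), int (w (inv w x)))" using e by (simp add: permutes_inverses[OF w])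
  ultimately show "e \<in> rothe_diagram n w" unfolding rothe_diagram_def by blast
qed

text \<open>With one rook for each of the \<open>a * b\<close> indices the combined sum is
  constantly \<open>a * b\<close>, while a label at the box \<open>(row y, col x)\<close> is
  attacked by \<open>a\<close> rooks along its column and \<open>b\<close> along its row.\<close>

lemma (in initial_weak_interval) edge_density_balanced:
  fixes row col :: "nat \<Rightarrow> int"
  assumes rows: "balanced_rows D a b N M" and D: "D \<subseteq> rectangle a b" and ab: "0 < a" "0 < b"
    and inj: "inj row" "inj col" and D_img: "D = (\<lambda>(x, y). (row y, col x)) ` I w"
  shows "tCDE L \<and> edge_density L = real a * real b / (real a + real b)"
proof -
  interpret balanced_rows D a b N M by (rule rows)
  have mem: "(row y, col x) \<in> D \<longleftrightarrow> (x, y) \<in> I w" for x y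
    using inj unfolding D_img by (auto simp: inj_eq)
  have "\<exists>e. e \<in> I w \<and> row (snd e) = diag_row a b t \<and> col (fst e) = diag_col a t" if "t < a * b" for t
    using diag_in_shape[OF that] unfolding D_img by force
  then obtain e where e: "\<And>t. t < a * b \<Longrightarrow> e t \<in> I w \<and> row (snd (e t)) = diag_row a b t \<and> col (fst (e t)) = diag_col a t"
    by metis
  have rook: "rook n w (fst (e t)) (snd (e t))" if t: "t < a * b" for t
  proof
    show "(fst (e t), snd (e t)) \<in> I w" using e[OF t] by simp
    fix x y assume "(x, snd (e t)) \<in> I w" "(fst (e t), y) \<in> I w"
    then have "(row y, diag_col a t) \<in> D" "(diag_row a b t, col x) \<in> D"
      using e[OF t] mem by metis+
    then show "(x, y) \<in> I w" using diag_rectangle_closed[OF t] mem by blast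
  qed
  let ?T = "{..<a * b}"
  let ?f = "\<lambda>p. \<Sum>t\<in>?T. rook_up n w (e t) p" and ?g = "\<lambda>p. \<Sum>t\<in>?T. rook_down n w (e t) p"
  have "tCDE L \<and> edge_density L = (real a * real b) / (real a + real b)"
  proof (rule L.tCDE_edge_densityI)
    fix u assume u: "u \<in> carrier L"
    have "(\<Sum>v | covers L u v. ?f (cover_label L u v)) + (\<Sum>v | covers L v u. ?g (cover_label L v u))
      = (\<Sum>t\<in>?T. (\<Sum>v | covers L u v. rook_up n w (e t) (cover_label L u v))
          + (\<Sum>v | covers L v u. rook_down n w (e t) (cover_label L v u)))"
      unfolding sum.distrib by (intro arg_cong2[where f = "(+)"] sum.swap)
    also have "\<dots> = (\<Sum>t\<in>?T. 1)"
      using rook.rook_sum_eq_1[OF rook u] by (intro sum.cong) auto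
    finally show "(\<Sum>v | covers L u v. ?f (cover_label L u v)) + (\<Sum>v | covers L v u. ?g (cover_label L v u))
      = real a * real b" by simp
  next
    fix u v assume c: "covers L u v"
    let ?p = "cover_label L u v"
    obtain k where k: "1 \<le> k" "k < n" "u k < u (Suc k)" "(u k, u (Suc k)) \<in> I w" "v = swap_at u k"
      using covers_imp_swap_at[OF c] .
    have u: "u \<in> carrier L" using L.covers_less[OF c] by simp
    define x y where "x = descent_low n ?p" and "y = descent_high n ?p"
    have xy: "(x, y) \<in> I w"
      using cover_label_swap_at(1,2)[OF u k(1-4)] k(4) unfolding x_def y_def k(5) by simp
    \<comment> \<open>The swapped pair is itself a box of the shape, so its row and column lie in
      the range of the counting lemmas.\<close>
    then have "(row y, col x) \<in> rectangle a b" using mem D by blast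
    then have range: "1 \<le> row y" "row y \<le> int a" "1 \<le> col x" "col x \<le> int b" by (auto simp: mem_rectangle)
    have "?f ?p + ?g ?p = (\<Sum>t\<in>?T. rook_up n w (e t) ?p + rook_down n w (e t) ?p)"
      by (simp add: sum.distrib)
    also have "\<dots> = (\<Sum>t\<in>?T. of_bool (diag_col a t = col x) + of_bool (diag_row a b t = row y))"
    proof (rule sum.cong)
      fix t assume "t \<in> ?T"
      then have t: "e t \<in> I w" "diag_row a b t = row (snd (e t))" "diag_col a t = col (fst (e t))"
        using e by auto
      have "rook_up n w (e t) ?p + rook_down n w (e t) ?p = of_bool (x = fst (e t)) + of_bool (y = snd (e t))"
        using rook_up_down[of "fst (e t)" "snd (e t)" n w ?p] t(1) xy by (simp add: x_def y_def)
      then show "rook_up n w (e t) ?p + rook_down n w (e t) ?p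
          = of_bool (diag_col a t = col x) + of_bool (diag_row a b t = row y)"
        unfolding t using inj by (auto simp: inj_eq)
    qed simp
    also have "\<dots> = real (card {t \<in> ?T. diag_col a t = col x}) + real (card {t \<in> ?T. diag_row a b t = row y})"
      unfolding sum.distrib by (simp add: sum_of_bool_eq Int_def conj_commute)
    also have "\<dots> = real a + real b"
      using card_diag_col card_diag_row range by simp
    finally show "?f ?p + ?g ?p = real a + real b" .
  next
    show "real a + real b \<noteq> 0" using ab by simp
  qed
  then show ?thesis .
qed

theorem theorem5p18:
  fixes lam nu :: "nat \<Rightarrow> nat" and \<sigma> :: diagram and a b n :: nat and w :: "nat \<Rightarrow> nat"
  assumes "is_partition lam" and "is_partition nu" and "\<forall>i\<ge>1. nu i \<le> lam i"
    and "\<sigma> = skew_diagram lam nu"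
    and "balanced \<sigma>" and "has_height_width \<sigma> a b"
    and "w permutes {1..n}" and "vexillary_of_shape n w \<sigma>"
  shows "tCDE (weak_interval n w) \<and>
    edge_density (weak_interval n w) = real a * real b / (real a + real b)"
proof -
  interpret initial_weak_interval n w by unfold_locales fact
  obtain d N M where d: "balanced_rows (translate d \<sigma>) a b N M" "translate d \<sigma> \<subseteq> rectangle a b" "0 < a" "0 < b"
    using balanced_skew_rows assms(1,2,4-6) by blast
  obtain f g where fg: "bij f" "bij g" "(\<lambda>(i, j). (f i, g j)) ` rothe_diagram n w = \<sigma>"
    using assms(8) by (auto simp: vexillary_of_shape_def)
  \<comment> \<open>Rothe coordinates after the given reordering of rows and columns, followed by
    the translation into the rectangle.\<close>
  define row where "row y = f (int (inv w y)) + fst d" for y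
  define col where "col x = g (int x) + snd d" for x
  show ?thesis
  proof (rule edge_density_balanced[OF d, of row col])
    show "inj row"
      using bij_is_inj[OF fg(1)] permutes_inj[OF permutes_inv[OF assms(7)]]
      by (intro injI) (simp add: row_def inj_eq)
    show "inj col" using bij_is_inj[OF fg(2)] by (intro injI) (simp add: col_def inj_eq)
    show "translate d \<sigma> = (\<lambda>(x, y). (row y, col x)) ` Inv n (inv w)"
      unfolding translate_def fg(3)[symmetric] rothe_diagram_eq[OF assms(7)] image_image row_def col_def
      by (intro image_cong) auto
  qed
qed

end
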